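(* Let $n>2$ be even and let $\mathbf a_0,\dots,\mathbf a_{n-1}$ be complex random variables such that the real random vector $\tilde{\mathbf a}=(\Re[\mathbf a_0],\dots,\Re[\mathbf a_{n-1}],\Im[\mathbf a_0],\dots,\Im[\mathbf a_{n-1}])\in\mathbb R^{2n}$ is spherically distributed and has a density with respect to Lebesgue measure. Let $h_n$ be the associated condensed density. Then: (1) $h_n$ does not depend on the specific distribution of $\tilde{\mathbf a}$: it is the same for all $\tilde{\mathbf a}$ that are $2n$-variate spherically distributed with a density. (2) In polar coordinates $z=\rho e^{i\theta}$, the marginal condensed density with respect to $\rho$ does not depend on $\theta$, and the marginal condensed density with respect to $\theta$ is uniform (on $(0,2\pi]$). (3) The condensed density is invariant under scaling of $\tilde{\mathbf a}$: for every real $c>0$, replacing $\tilde{\mathbf a}$ by $c\,\tilde{\mathbf a}$ leaves $h_n$ unchanged.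
   Context: A random vector in $\mathbb R^m$ is spherically distributed if its law is invariant under all orthogonal transformations of $\mathbb R^m$. For even $n$ and complex random variables $\mathbf a_0,\dots,\mathbf a_{n-1}$, put $p=n/2$ and let $U(\mathbf a_0,\dots,\mathbf a_{n-2})$ denote the $p\times p$ Hankel matrix with $(i,j)$ entry $\mathbf a_{i+j-2}$, $1\le i,j\le p$, and $U(\mathbf a_1,\dots,\mathbf a_{n-1})$ the one with $(i,j)$ entry $\mathbf a_{i+j-1}$. Let $\boldsymbol\zeta_1,\dots,\boldsymbol\zeta_{n/2}$ (the "Padé poles") be the generalized eigenvalues of the pencil, i.e. the roots in $z$ of $\det[U(\mathbf a_1,\dots,\mathbf a_{n-1})-zU(\mathbf a_0,\dots,\mathbf a_{n-2})]$; almost surely they are the numbers $\boldsymbol\zeta_j$ for which $\mathbf a_k=\sum_{j=1}^{n/2}\boldsymbol\gamma_j\boldsymbol\zeta_j^k$, $k=0,\dots,n-1$, for some complex $\boldsymbol\gamma_j$. The condensed density is $h_n(z)=\frac{2}{n}E\big[\sum_{j=1}^{n/2}\delta(z-\boldsymbol\zeta_j)\big]$, the expectation being with respect to the density of $(\mathbf a_0,\dots,\mathbf a_{n-1})$; i.e. $\int_B h_n(z)\,dz=\frac2nE[\#\{j:\boldsymbol\zeta_j\in B\}]$ for every Borel set $B\subset\mathbb C$, where $dz$ is two-dimensional Lebesgue measure. The marginal condensed densities with respect to $\rho$ and $\theta$ are the marginals of the density $\rho\,h_n(\rho e^{i\theta})$ on $(0,\infty)\times(0,2\pi]$. *)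

theory Defs
  imports "HOL-Probability.Probability" "Jordan_Normal_Form.Determinant"
begin

definition spherically_distributed ::
    "'w measure \<Rightarrow> nat \<Rightarrow> ('w \<Rightarrow> nat \<Rightarrow> real) \<Rightarrow> bool" where
  "spherically_distributed M m X \<longleftrightarrow>
     X \<in> measurable M (\<Pi>\<^sub>M i\<in>{..<m}. borel) \<and>
     (\<forall>Q \<in> carrier_mat m m. transpose_mat Q * Q = 1\<^sub>m m \<longrightarrow>
        distr M (\<Pi>\<^sub>M i\<in>{..<m}. borel) (\<lambda>\<omega>. \<lambda>i\<in>{..<m}. \<Sum>j<m. Q $$ (i, j) * X \<omega> j)
        = distr M (\<Pi>\<^sub>M i\<in>{..<m}. borel) X)"

definition has_lebesgue_density ::
    "'w measure \<Rightarrow> nat \<Rightarrow> ('w \<Rightarrow> nat \<Rightarrow> real) \<Rightarrow> bool" where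
  "has_lebesgue_density M m X \<longleftrightarrow> (\<exists>f. distributed M (\<Pi>\<^sub>M i\<in>{..<m}. lborel) X f)"

definition real_vector_of :: "nat \<Rightarrow> (nat \<Rightarrow> 'w \<Rightarrow> complex) \<Rightarrow> 'w \<Rightarrow> nat \<Rightarrow> real" where
  "real_vector_of n a \<omega> =
     (\<lambda>i\<in>{..<2 * n}. if i < n then Re (a i \<omega>) else Im (a (i - n) \<omega>))"

text \<open>Indices are shifted to start at 0: the matrix has entries \<open>s (i + j)\<close> for \<open>i, j < p\<close>.\<close>

definition hankel :: "nat \<Rightarrow> (nat \<Rightarrow> complex) \<Rightarrow> complex mat" where
  "hankel p s = mat p p (\<lambda>(i, j). s (i + j))"

text \<open>The determinant of the pencil \<open>U(s 1, \<dots>, s (n - 1)) - z U(s 0, \<dots>, s (n - 2))\<close>,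
  as a polynomial in \<open>z\<close>.\<close>

definition pade_poly :: "nat \<Rightarrow> (nat \<Rightarrow> complex) \<Rightarrow> complex poly" where
  "pade_poly n s =
     det (map_mat (\<lambda>c. [:c:]) (hankel (n div 2) (\<lambda>k. s (k + 1)))
          - [:0, 1:] \<cdot>\<^sub>m map_mat (\<lambda>c. [:c:]) (hankel (n div 2) s))"

text \<open>Poles are counted with multiplicity. If the determinant vanishes identically the multiset
  is empty, since \<open>proots 0 = {#}\<close>; under the density assumption this is a null event.\<close>

definition pade_poles :: "nat \<Rightarrow> (nat \<Rightarrow> complex) \<Rightarrow> complex multiset" where
  "pade_poles n s = proots (pade_poly n s)"

text \<open>A condensed density is determined only up to Lebesgue null sets, so the notion is a
  predicate saying that \<open>h\<close> is a version of it.\<close>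

definition condensed_density ::
    "'w measure \<Rightarrow> nat \<Rightarrow> (nat \<Rightarrow> 'w \<Rightarrow> complex) \<Rightarrow> (complex \<Rightarrow> real) \<Rightarrow> bool" where
  "condensed_density M n a h \<longleftrightarrow>
     h \<in> borel_measurable borel \<and> (\<forall>z. 0 \<le> h z) \<and>
     (\<forall>B \<in> sets borel.
        (\<integral>\<^sup>+z\<in>B. ennreal (h z) \<partial>lborel)
        = ennreal (2 / real n) *
          (\<integral>\<^sup>+\<omega>. of_nat (size {# \<zeta> \<in># pade_poles n (\<lambda>k. a k \<omega>). \<zeta> \<in> B #}) \<partial>M))"

definition polar_density :: "(complex \<Rightarrow> real) \<Rightarrow> real \<Rightarrow> real \<Rightarrow> real" where
  "polar_density h \<rho> \<theta> = \<rho> * h (rcis \<rho> \<theta>)"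

definition marginal_rho :: "(complex \<Rightarrow> real) \<Rightarrow> real \<Rightarrow> ennreal" where
  "marginal_rho h \<rho> = (\<integral>\<^sup>+\<theta>\<in>{0<..2 * pi}. ennreal (polar_density h \<rho> \<theta>) \<partial>lborel)"

definition marginal_theta :: "(complex \<Rightarrow> real) \<Rightarrow> real \<Rightarrow> ennreal" where
  "marginal_theta h \<theta> = (\<integral>\<^sup>+\<rho>\<in>{0<..}. ennreal (polar_density h \<rho> \<theta>) \<partial>lborel)"

end

theory Submission
  imports Defs "HOL-Computational_Algebra.Fundamental_Theorem_Algebra"
begin

text \<open>
  Up to the factor \<open>2 / n\<close>, the expected number of Pade poles in a Borel set \<open>B\<close> is the
  probability that one pole, drawn uniformly from the \<open>n / 2\<close> poles, falls into \<open>B\<close>. So the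
  condensed density is the density of the law of a random pole (\<open>pole_law\<close>), and the theorem
  is a list of properties of that law. They come from three transformation rules of the poles:
  \<^item> multiplying all \<open>a k\<close> by one non-zero scalar leaves the poles where they are;
  \<^item> replacing \<open>a k\<close> by \<open>l ^ k * a k\<close> multiplies every pole by \<open>l\<close> (\<open>pade_poles_dilate\<close>);
  \<^item> for \<open>\<bar>l\<bar> = 1\<close> the latter is an orthogonal map of the \<open>2 n\<close> real coordinates.

  The first rule gives the scaling invariance at once, and it shows that the poles depend only on
  the direction of the coefficient vector. The direction of an orthogonally invariant
  vector that is almost surely non-zero has only one possible law, the uniform one on the sphere
  (\<open>directional_law_unique\<close>); hence the pole law is the same for all spherical distributions.

  The second and third rules show that the pole law is invariant under rotations of the plane. A
  rotation-invariant planar law has a density as soon as the law of the modulus is absolutely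
  continuous, and the density then depends on the modulus only
  (\<open>rotation_invariant_radial_density\<close>); in polar coordinates this is the claim about the
  marginals. That no pole has its modulus in a given null set \<open>R\<close> follows from the second rule
  with \<open>l\<close> real (\<open>AE_no_pole_radius\<close>): dilations by \<open>r > 0\<close> preserve Lebesgue null sets of
  coefficient vectors, and for a fixed vector only a null set of \<open>r\<close> moves one of its finitely
  many non-zero poles into \<open>R\<close>.

  Two technical points remain. Outside a null set the pencil has exactly \<open>n / 2\<close> poles, none of them
  zero, because Hankel determinants are polynomials that do not vanish identically along a suitable
  coordinate axis (\<open>AE_det_hankel_nz\<close>). And there the number of poles in \<open>B\<close> is a measurable function of
  the coefficients, because the roots of a polynomial can be listed in a measurable way
  (\<open>measurable_poly_roots\<close>).
\<close>

section \<open>Orthogonally invariant measures on the sphere\<close>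

definition mat_act :: "nat \<Rightarrow> real mat \<Rightarrow> (nat \<Rightarrow> real) \<Rightarrow> nat \<Rightarrow> real" where
  "mat_act m Q x = (\<lambda>i\<in>{..<m}. \<Sum>j<m. Q $$ (i, j) * x j)"

definition orthogonal_mat :: "nat \<Rightarrow> real mat \<Rightarrow> bool" where
  "orthogonal_mat m Q \<longleftrightarrow> Q \<in> carrier_mat m m \<and> transpose_mat Q * Q = 1\<^sub>m m"

lemma orthogonal_mat_iff:
  assumes "Q \<in> carrier_mat m m"
  shows "orthogonal_mat m Q \<longleftrightarrow>
    (\<forall>j<m. \<forall>l<m. (\<Sum>i<m. Q $$ (i, j) * Q $$ (i, l)) = (if j = l then 1 else 0))"
proof -
  have *: "(transpose_mat Q * Q) $$ (j, l) = (\<Sum>i<m. Q $$ (i, j) * Q $$ (i, l))"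
    if "j < m" "l < m" for j l
    using assms that by (auto simp: scalar_prod_def lessThan_atLeast0 intro!: sum.cong)
  show ?thesis
    unfolding orthogonal_mat_def using assms *
    by (auto simp: mat_eq_iff)
qed

lemma sum_sq_mat_act:
  assumes "orthogonal_mat m Q"
  shows "(\<Sum>i<m. (mat_act m Q x i)\<^sup>2) = (\<Sum>i<m. (x i)\<^sup>2)"
proof -
  have Q: "Q \<in> carrier_mat m m" using assms by (simp add: orthogonal_mat_def)
  have "(\<Sum>i<m. (mat_act m Q x i)\<^sup>2) = (\<Sum>i<m. \<Sum>j<m. \<Sum>l<m. (Q $$ (i, j) * x j) * (Q $$ (i, l) * x l))"
    by (simp add: mat_act_def power2_eq_square sum_product)
  also have "\<dots> = (\<Sum>j<m. \<Sum>i<m. \<Sum>l<m. (Q $$ (i, j) * x j) * (Q $$ (i, l) * x l))"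
    by (rule sum.swap)
  also have "\<dots> = (\<Sum>j<m. \<Sum>l<m. \<Sum>i<m. (Q $$ (i, j) * x j) * (Q $$ (i, l) * x l))"
    by (intro sum.cong refl sum.swap)
  also have "\<dots> = (\<Sum>j<m. \<Sum>l<m. x j * x l * (\<Sum>i<m. Q $$ (i, j) * Q $$ (i, l)))"
    by (simp add: sum_distrib_left mult_ac)
  also have "\<dots> = (\<Sum>j<m. \<Sum>l<m. x j * x l * (if j = l then 1 else 0))"
    using assms by (intro sum.cong refl) (simp add: orthogonal_mat_iff[OF Q])
  also have "\<dots> = (\<Sum>i<m. (x i)\<^sup>2)"
    by (simp add: power2_eq_square if_distrib cong: if_cong)
  finally show ?thesis .
qed

lemma mat_act_diff:
  "i < m \<Longrightarrow> mat_act m Q x i - mat_act m Q y i = mat_act m Q (\<lambda>j. x j - y j) i"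
  by (simp add: mat_act_def sum_subtractf algebra_simps)

lemma sum_sq_diff_mat_act:
  assumes "orthogonal_mat m Q"
  shows "(\<Sum>i<m. (mat_act m Q x i - mat_act m Q y i)\<^sup>2) = (\<Sum>i<m. (x i - y i)\<^sup>2)"
  using sum_sq_mat_act[OF assms, of "\<lambda>j. x j - y j"] by (simp add: mat_act_diff)

text \<open>The reflection in the hyperplane orthogonal to \<open>w\<close>. For \<open>w = 0\<close> division by zero makes it the identity.\<close>

definition householder :: "nat \<Rightarrow> (nat \<Rightarrow> real) \<Rightarrow> real mat" where
  "householder m w =
     mat m m (\<lambda>(i, j). (if i = j then 1 else 0) - 2 * w i * w j / (\<Sum>k<m. (w k)\<^sup>2))"

lemma orthogonal_householder: "orthogonal_mat m (householder m w)"
proof -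
  define W where "W = (\<Sum>k<m. (w k)\<^sup>2)"
  have "(\<Sum>i<m. ((if i = j then 1 else 0) - 2 * w i * w j / W) * ((if i = l then 1 else 0) - 2 * w i * w l / W))
      = (if j = l then 1 else 0)" if "j < m" "l < m" for j l
  proof -
    have "(\<Sum>i<m. ((if i = j then 1 else 0) - 2 * w i * w j / W) * ((if i = l then 1 else 0) - 2 * w i * w l / W))
        = (\<Sum>i<m. (if i = j then (if i = l then 1 else 0) else 0)
            - (if i = j then 2 * w i * w l / W else 0) - (if i = l then 2 * w i * w j / W else 0)
            + 4 * w j * w l / W\<^sup>2 * (w i)\<^sup>2)"
      by (intro sum.cong refl, cases "W = 0") (auto simp: field_simps power2_eq_square)
    also have "\<dots> = (if j = l then 1 else 0) - 4 * w j * w l / W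
        + 4 * w j * w l / W\<^sup>2 * (\<Sum>i<m. (w i)\<^sup>2)"
      using that by (simp add: sum.distrib sum_subtractf sum_distrib_left)
    also have "\<dots> = (if j = l then 1 else 0) - 4 * w j * w l / W + 4 * w j * w l / W\<^sup>2 * W"
      by (simp add: W_def)
    also have "\<dots> = (if j = l then 1 else 0)"
      by (simp add: power2_eq_square)
    finally show ?thesis .
  qed
  then show ?thesis
    by (subst orthogonal_mat_iff) (auto simp: householder_def W_def)
qed

lemma householder_maps:
  assumes "(\<Sum>i<m. (u i)\<^sup>2) = (\<Sum>i<m. (v i)\<^sup>2)" "i < m"
  shows "mat_act m (householder m (\<lambda>k. u k - v k)) u i = v i"
proof -
  define W where "W = (\<Sum>k<m. (u k - v k)\<^sup>2)"
  have W: "W = 2 * (\<Sum>k<m. (u k - v k) * u k)"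
    using assms(1) unfolding W_def
    by (simp add: power2_eq_square algebra_simps sum.distrib sum_subtractf sum_distrib_left)
  have "mat_act m (householder m (\<lambda>k. u k - v k)) u i
      = (\<Sum>j<m. (if i = j then u j else 0) - 2 * (u i - v i) / W * ((u j - v j) * u j))"
    using assms(2) by (simp add: mat_act_def householder_def W_def) (auto intro!: sum.cong simp: algebra_simps)
  also have "\<dots> = u i - 2 * (u i - v i) / W * (\<Sum>j<m. (u j - v j) * u j)"
    using assms(2) by (simp add: sum_subtractf sum_distrib_left)
  also have "\<dots> = u i - (u i - v i) / W * W"
    by (simp add: W)
  also have "\<dots> = v i"
  proof (cases "W = 0")
    case True
    then have "u i - v i = 0" using assms(2) unfolding W_def
      by (subst (asm) sum_nonneg_eq_0_iff) auto
    then show ?thesis by simp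
  qed simp
  finally show ?thesis .
qed

definition orthogonally_invariant :: "nat \<Rightarrow> (nat \<Rightarrow> real) measure \<Rightarrow> bool" where
  "orthogonally_invariant m \<mu> \<longleftrightarrow> sets \<mu> = sets (\<Pi>\<^sub>M i\<in>{..<m}. borel) \<and>
     (\<forall>Q. orthogonal_mat m Q \<longrightarrow> distr \<mu> (\<Pi>\<^sub>M i\<in>{..<m}. borel) (mat_act m Q) = \<mu>)"

lemma measurable_mat_act [measurable]:
  "mat_act m Q \<in> measurable (\<Pi>\<^sub>M i\<in>{..<m}. borel) (\<Pi>\<^sub>M i\<in>{..<m}. borel)"
  unfolding mat_act_def by measurable

abbreviation coord_space :: "nat \<Rightarrow> (nat \<Rightarrow> real) measure" where
  "coord_space m \<equiv> (\<Pi>\<^sub>M i\<in>{..<m}. borel)"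

text \<open>A reflection carries one centre to the other, and it preserves both the measure and the
  distances. So the caps with a given radius around points of the unit sphere all have the same measure.\<close>

lemma cap_measure_eq:
  assumes inv: "orthogonally_invariant m \<mu>"
    and uv: "(\<Sum>i<m. (u i)\<^sup>2) = (\<Sum>i<m. (v i)\<^sup>2)"
  shows "emeasure \<mu> {x\<in>space (coord_space m). (\<Sum>i<m. (x i - v i)\<^sup>2) < e}
       = emeasure \<mu> {x\<in>space (coord_space m). (\<Sum>i<m. (x i - u i)\<^sup>2) < e}"
proof -
  define Q where "Q = householder m (\<lambda>k. u k - v k)"
  have Q: "orthogonal_mat m Q" unfolding Q_def by (rule orthogonal_householder)
  have sets: "sets \<mu> = sets (coord_space m)" using inv by (simp add: orthogonally_invariant_def)
  then have [measurable_cong]: "sets \<mu> = sets (coord_space m)" .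
  have sp: "space \<mu> = space (coord_space m)" using sets by (rule sets_eq_imp_space_eq)
  have Qu: "mat_act m Q u i = v i" if "i < m" for i
    unfolding Q_def using householder_maps[OF uv that] .
  have "emeasure \<mu> {x\<in>space (coord_space m). (\<Sum>i<m. (x i - v i)\<^sup>2) < e}
      = emeasure (distr \<mu> (coord_space m) (mat_act m Q)) {x\<in>space (coord_space m). (\<Sum>i<m. (x i - v i)\<^sup>2) < e}"
    using inv Q by (simp add: orthogonally_invariant_def)
  also have "\<dots> = emeasure \<mu> (mat_act m Q -` {x\<in>space (coord_space m). (\<Sum>i<m. (x i - v i)\<^sup>2) < e} \<inter> space \<mu>)"
    by (rule emeasure_distr) measurable
  also have "mat_act m Q -` {x\<in>space (coord_space m). (\<Sum>i<m. (x i - v i)\<^sup>2) < e} \<inter> space \<mu>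
      = {x\<in>space (coord_space m). (\<Sum>i<m. (x i - u i)\<^sup>2) < e}"
    using measurable_space[OF measurable_mat_act[of m Q]] sum_sq_diff_mat_act[OF Q, of _ u]
    by (auto simp: sp Qu)
  finally show ?thesis .
qed

text \<open>If one cap were null, all of them would be. A sufficiently fine cubical grid has only countably
  many cells, and every cell that meets the sphere lies in a cap centred on the sphere, so the
  whole measure would vanish.\<close>

lemma cap_measure_pos:
  assumes pr: "prob_space \<mu>" and inv: "orthogonally_invariant m \<mu>"
    and sph: "AE x in \<mu>. (\<Sum>i<m. (x i)\<^sup>2) = 1"
    and v: "(\<Sum>i<m. (v i)\<^sup>2) = 1" and e: "e > 0"
  shows "emeasure \<mu> {x\<in>space (coord_space m). (\<Sum>i<m. (x i - v i)\<^sup>2) < e} > 0"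
proof (rule ccontr)
  assume "\<not> ?thesis"
  then have zero: "emeasure \<mu> {x\<in>space (coord_space m). (\<Sum>i<m. (x i - v i)\<^sup>2) < e} = 0"
    by (simp add: not_gr_zero)
  interpret prob_space \<mu> by fact
  have sets: "sets \<mu> = sets (coord_space m)" using inv by (simp add: orthogonally_invariant_def)
  then have [measurable_cong]: "sets \<mu> = sets (coord_space m)" .
  have sp: "space \<mu> = space (coord_space m)" using sets by (rule sets_eq_imp_space_eq)
  \<comment> \<open>Points of one grid cell of side \<open>1 / K\<close> have squared distance at most \<open>m / K\<^sup>2 < e\<close>.\<close>
  obtain K :: nat where K: "real m / e < real K" using reals_Archimedean2 by blast
  have "0 \<le> real m / e" using e by simp
  then have K0: "K > 0" using K by linarith
  have Ke: "real m * (1 / real K)\<^sup>2 < e"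
  proof -
    have "real m < e * real K" using K e by (simp add: field_simps)
    also have "\<dots> \<le> e * (real K)\<^sup>2" using e K0
      by (intro mult_left_mono) (auto simp: power2_eq_square)
    finally show ?thesis using K0 by (simp add: field_simps)
  qed
  define cell where "cell q = {x\<in>space (coord_space m). \<forall>i<m. \<lfloor>real K * x i\<rfloor> = q i}" for q :: "nat \<Rightarrow> int"
  have cell_sets[measurable]: "cell q \<in> sets (coord_space m)" for q
    unfolding cell_def by measurable
  have null: "AE x in \<mu>. x \<notin> cell q" for q
  proof (cases "\<exists>w\<in>cell q. (\<Sum>i<m. (w i)\<^sup>2) = 1")
    case True
    then obtain w where w: "w \<in> cell q" "(\<Sum>i<m. (w i)\<^sup>2) = 1" by blast
    have "emeasure \<mu> {x\<in>space (coord_space m). (\<Sum>i<m. (x i - w i)\<^sup>2) < e} = 0"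
      using cap_measure_eq[OF inv, of v w e] v w(2) zero by simp
    then have *: "AE x in \<mu>. x \<notin> {x\<in>space (coord_space m). (\<Sum>i<m. (x i - w i)\<^sup>2) < e}"
      by (intro AE_not_in null_setsI) (auto simp: sets)
    have close: "(\<Sum>i<m. (x i - w i)\<^sup>2) < e" if "x \<in> cell q" for x
    proof -
      have "(x i - w i)\<^sup>2 \<le> (1 / real K)\<^sup>2" if i: "i < m" for i
      proof -
        have "\<lfloor>real K * x i\<rfloor> = \<lfloor>real K * w i\<rfloor>" using \<open>x \<in> cell q\<close> w(1) i by (simp add: cell_def)
        then have "\<bar>real K * x i - real K * w i\<bar> \<le> 1" by linarith
        moreover have "\<bar>real K * x i - real K * w i\<bar> = real K * \<bar>x i - w i\<bar>"
          by (metis abs_mult abs_of_nat right_diff_distrib)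
        ultimately have "\<bar>x i - w i\<bar> \<le> \<bar>1 / real K\<bar>" using K0
          by (simp add: field_simps)
        then show ?thesis by (simp only: abs_le_square_iff)
      qed
      then have "(\<Sum>i<m. (x i - w i)\<^sup>2) \<le> (\<Sum>i<m. (1 / real K)\<^sup>2)"
        by (intro sum_mono) simp
      then show ?thesis using Ke by simp
    qed
    from * show ?thesis
      by eventually_elim (use close in \<open>auto simp: cell_def\<close>)
  next
    case False
    with sph show ?thesis by (auto elim!: eventually_mono)
  qed
  have "AE x in \<mu>. \<forall>q\<in>PiE {..<m} (\<lambda>_. UNIV). x \<notin> cell q"
    using null by (subst AE_ball_countable) (auto intro!: countable_PiE)
  moreover have "AE x in \<mu>. x \<in> space \<mu>" by (rule AE_space)
  ultimately have "AE x in \<mu>. False"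
  proof eventually_elim
    case (elim x)
    have "x \<in> cell (\<lambda>i\<in>{..<m}. \<lfloor>real K * x i\<rfloor>)"
      using elim(2) by (auto simp: cell_def sp)
    with elim(1) show False by auto
  qed
  then show False by simp
qed

text \<open>The kernel \<open>k x y\<close> that tests whether \<open>x\<close> and \<open>y\<close> are closer than \<open>e\<close> integrates to the common cap
  measure in either variable if the other one lies on the sphere, and Fubini shows that this constant is the same for \<open>\<mu>\<close> and \<open>\<nu>\<close>.
  If \<open>x\<close> is in the orthant and \<open>y\<close> is closer than \<open>e\<close> to \<open>x\<close>, then \<open>y\<close> is in the orthant
  enlarged by \<open>e\<close>; integrating this over \<open>\<mu> \<Otimes> \<nu>\<close> and cancelling the constant, which is positive,
  yields the inequality. This is the classical argument (due to Christensen) for the uniqueness of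
  uniformly distributed measures.\<close>

lemma orthant_measure_le:
  assumes \<mu>: "prob_space \<mu>" "orthogonally_invariant m \<mu>" "AE x in \<mu>. (\<Sum>i<m. (x i)\<^sup>2) = 1"
    and \<nu>: "prob_space \<nu>" "orthogonally_invariant m \<nu>" "AE x in \<nu>. (\<Sum>i<m. (x i)\<^sup>2) = 1"
    and e: "e > 0"
  shows "emeasure \<mu> {x\<in>space (coord_space m). \<forall>i<m. x i \<le> c i}
       \<le> emeasure \<nu> {x\<in>space (coord_space m). \<forall>i<m. x i \<le> c i + e}"
proof -
  let ?S = "coord_space m"
  interpret m: prob_space \<mu> by fact
  interpret n: prob_space \<nu> by fact
  interpret mn: pair_sigma_finite \<mu> \<nu> ..
  have [measurable_cong]: "sets \<mu> = sets ?S" "sets \<nu> = sets ?S"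
    using \<mu>(2) \<nu>(2) by (simp_all add: orthogonally_invariant_def)
  have sp: "space \<mu> = space ?S" "space \<nu> = space ?S"
    using \<mu>(2) \<nu>(2) by (auto simp add: orthogonally_invariant_def dest: sets_eq_imp_space_eq)
  define cap where "cap v = {x\<in>space ?S. (\<Sum>i<m. (x i - v i)\<^sup>2) < e\<^sup>2}" for v :: "nat \<Rightarrow> real"
  have cap_sets: "cap v \<in> sets ?S" for v unfolding cap_def by measurable
  define k :: "(nat \<Rightarrow> real) \<Rightarrow> (nat \<Rightarrow> real) \<Rightarrow> ennreal"
    where "k x y = (if (\<Sum>i<m. (x i - y i)\<^sup>2) < e\<^sup>2 then 1 else 0)" for x y
  have k_meas [measurable]: "(\<lambda>(x, y). k x y) \<in> borel_measurable (?S \<Otimes>\<^sub>M ?S)"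
    unfolding k_def by measurable
  have k_sym: "k x y = k y x" for x y unfolding k_def
    by (simp add: power2_commute)
  define A where "A = {x\<in>space ?S. \<forall>i<m. x i \<le> c i}"
  define B where "B = {x\<in>space ?S. \<forall>i<m. x i \<le> c i + e}"
  have [measurable]: "A \<in> sets ?S" "B \<in> sets ?S" unfolding A_def B_def by measurable
  have "\<exists>w\<in>space \<mu>. (\<Sum>i<m. (w i)\<^sup>2) = 1"
  proof (rule ccontr)
    assume neg: "\<not> ?thesis"
    have "AE x in \<mu>. False"
      using \<mu>(3) AE_space by eventually_elim (use neg in blast)
    then show False by simp
  qed
  then obtain w where w: "w \<in> space \<mu>" "(\<Sum>i<m. (w i)\<^sup>2) = 1" by blast
  have int_mu: "(\<integral>\<^sup>+x. k x y \<partial>\<mu>) = emeasure \<mu> (cap w)" if "(\<Sum>i<m. (y i)\<^sup>2) = 1" for y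
  proof -
    have "(\<integral>\<^sup>+x. k x y \<partial>\<mu>) = (\<integral>\<^sup>+x. indicator (cap y) x \<partial>\<mu>)"
      by (intro nn_integral_cong) (auto simp: k_def cap_def sp split: split_indicator)
    also have "\<dots> = emeasure \<mu> (cap y)" using cap_sets by (intro nn_integral_indicator) measurable
    also have "\<dots> = emeasure \<mu> (cap w)" unfolding cap_def
      using that w by (intro cap_measure_eq[OF \<mu>(2)]) simp
    finally show ?thesis .
  qed
  have int_nu: "(\<integral>\<^sup>+x. k x y \<partial>\<nu>) = emeasure \<nu> (cap w)" if "(\<Sum>i<m. (y i)\<^sup>2) = 1" for y
  proof -
    have "(\<integral>\<^sup>+x. k x y \<partial>\<nu>) = (\<integral>\<^sup>+x. indicator (cap y) x \<partial>\<nu>)"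
      by (intro nn_integral_cong) (auto simp: k_def cap_def sp split: split_indicator)
    also have "\<dots> = emeasure \<nu> (cap y)" using cap_sets by (intro nn_integral_indicator) measurable
    also have "\<dots> = emeasure \<nu> (cap w)" unfolding cap_def
      using that w by (intro cap_measure_eq[OF \<nu>(2)]) simp
    finally show ?thesis .
  qed
  have fub: "(\<integral>\<^sup>+x. \<integral>\<^sup>+y. g x y * k x y \<partial>\<nu> \<partial>\<mu>) = (\<integral>\<^sup>+y. \<integral>\<^sup>+x. g x y * k x y \<partial>\<mu> \<partial>\<nu>)"
    if [measurable]: "(\<lambda>(x, y). g x y) \<in> borel_measurable (?S \<Otimes>\<^sub>M ?S)" for g :: "(nat \<Rightarrow> real) \<Rightarrow> (nat \<Rightarrow> real) \<Rightarrow> ennreal"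
    by (rule mn.Fubini'[symmetric]) measurable
  have left: "(\<integral>\<^sup>+x. \<integral>\<^sup>+y. f x * k x y \<partial>\<nu> \<partial>\<mu>) = emeasure \<nu> (cap w) * (\<integral>\<^sup>+x. f x \<partial>\<mu>)"
    if [measurable]: "f \<in> borel_measurable ?S" for f
  proof -
    have "(\<integral>\<^sup>+x. \<integral>\<^sup>+y. f x * k x y \<partial>\<nu> \<partial>\<mu>) = (\<integral>\<^sup>+x. emeasure \<nu> (cap w) * f x \<partial>\<mu>)"
    proof (rule nn_integral_cong_AE, use \<mu>(3) AE_space in eventually_elim)
      case (elim x)
      have "(\<integral>\<^sup>+y. f x * k x y \<partial>\<nu>) = f x * (\<integral>\<^sup>+y. k x y \<partial>\<nu>)"
        using elim(2) by (intro nn_integral_cmult) (simp add: sp)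
      also have "(\<integral>\<^sup>+y. k x y \<partial>\<nu>) = emeasure \<nu> (cap w)"
        using int_nu[OF elim(1)] by (subst k_sym)
      finally show ?case by (simp add: mult.commute)
    qed
    then show ?thesis by (simp add: nn_integral_cmult)
  qed
  have right: "(\<integral>\<^sup>+y. \<integral>\<^sup>+x. f y * k x y \<partial>\<mu> \<partial>\<nu>) = emeasure \<mu> (cap w) * (\<integral>\<^sup>+y. f y \<partial>\<nu>)"
    if [measurable]: "f \<in> borel_measurable ?S" for f
  proof -
    have "(\<integral>\<^sup>+y. \<integral>\<^sup>+x. f y * k x y \<partial>\<mu> \<partial>\<nu>) = (\<integral>\<^sup>+y. emeasure \<mu> (cap w) * f y \<partial>\<nu>)"
    proof (rule nn_integral_cong_AE, use \<nu>(3) AE_space in eventually_elim)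
      case (elim y)
      have "(\<integral>\<^sup>+x. f y * k x y \<partial>\<mu>) = f y * (\<integral>\<^sup>+x. k x y \<partial>\<mu>)"
        using elim(2) by (intro nn_integral_cmult) (simp add: sp)
      also have "(\<integral>\<^sup>+x. k x y \<partial>\<mu>) = emeasure \<mu> (cap w)"
        using int_mu[OF elim(1)] .
      finally show ?case by (simp add: mult.commute)
    qed
    then show ?thesis by (simp add: nn_integral_cmult)
  qed
  \<comment> \<open>The two iterated integrals of the kernel itself are the two cap measures.\<close>
  have C: "emeasure \<nu> (cap w) = emeasure \<mu> (cap w)"
    using fub[of "\<lambda>_ _. 1"] left[of "\<lambda>_. 1"] right[of "\<lambda>_. 1"] m.emeasure_space_1 n.emeasure_space_1 by simp
  have "emeasure \<mu> (cap w) * emeasure \<mu> A = (\<integral>\<^sup>+x. \<integral>\<^sup>+y. indicator A x * k x y \<partial>\<nu> \<partial>\<mu>)"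
    by (subst left) (simp_all add: C)
  also have "\<dots> \<le> (\<integral>\<^sup>+x. \<integral>\<^sup>+y. indicator B y * k x y \<partial>\<nu> \<partial>\<mu>)"
  proof (intro nn_integral_mono)
    fix x y assume "x \<in> space \<mu>" "y \<in> space \<nu>"
    show "indicator A x * k x y \<le> indicator B y * k x y"
    proof (cases "x \<in> A \<and> (\<Sum>i<m. (x i - y i)\<^sup>2) < e\<^sup>2")
      case True
      have "y i \<le> c i + e" if "i < m" for i
      proof -
        have "(x i - y i)\<^sup>2 \<le> (\<Sum>i<m. (x i - y i)\<^sup>2)"
          using that by (intro member_le_sum) auto
        also have "\<dots> < e\<^sup>2" using True by simp
        finally have "\<bar>x i - y i\<bar>\<^sup>2 < e\<^sup>2" by simp
        then have "\<bar>x i - y i\<bar> < e" using e by (intro power_less_imp_less_base[of _ 2 e]) auto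
        moreover have "x i \<le> c i" using True that by (simp add: A_def)
        ultimately show ?thesis by linarith
      qed
      then have "y \<in> B" using \<open>y \<in> space \<nu>\<close> by (auto simp: B_def sp)
      then show ?thesis by (simp split: split_indicator)
    qed (auto simp: k_def)
  qed
  also have "\<dots> = emeasure \<mu> (cap w) * emeasure \<nu> B"
    by (subst fub, measurable, subst right) simp_all
  finally have *: "emeasure \<mu> (cap w) * emeasure \<mu> A \<le> emeasure \<mu> (cap w) * emeasure \<nu> B" .
  have "emeasure \<mu> (cap w) \<noteq> 0"
    using cap_measure_pos[OF \<mu> w(2), of "e\<^sup>2"] e by (simp add: cap_def)
  moreover have "emeasure \<mu> (cap w) \<noteq> \<top>" by simp
  ultimately show ?thesis using * unfolding A_def[symmetric] B_def[symmetric]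
    by (simp add: ennreal_mult_le_mult_iff)
qed

lemma orthant_measure_eq:
  assumes \<mu>: "prob_space \<mu>" "orthogonally_invariant m \<mu>" "AE x in \<mu>. (\<Sum>i<m. (x i)\<^sup>2) = 1"
    and \<nu>: "prob_space \<nu>" "orthogonally_invariant m \<nu>" "AE x in \<nu>. (\<Sum>i<m. (x i)\<^sup>2) = 1"
  shows "emeasure \<mu> {x\<in>space (coord_space m). \<forall>i<m. x i \<le> c i}
       = emeasure \<nu> {x\<in>space (coord_space m). \<forall>i<m. x i \<le> c i}"
proof -
  have le: "emeasure \<mu> {x\<in>space (coord_space m). \<forall>i<m. x i \<le> c i}
       \<le> emeasure \<nu> {x\<in>space (coord_space m). \<forall>i<m. x i \<le> c i}"
    if \<mu>: "prob_space \<mu>" "orthogonally_invariant m \<mu>" "AE x in \<mu>. (\<Sum>i<m. (x i)\<^sup>2) = 1"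
    and \<nu>: "prob_space \<nu>" "orthogonally_invariant m \<nu>" "AE x in \<nu>. (\<Sum>i<m. (x i)\<^sup>2) = 1" for \<mu> \<nu>
  proof -
    interpret n: prob_space \<nu> by fact
    define B where "B k = {x\<in>space (coord_space m). \<forall>i<m. x i \<le> c i + 1 / real (Suc k)}" for k
    have [measurable]: "B k \<in> sets (coord_space m)" for k unfolding B_def by measurable
    have sets: "sets \<nu> = sets (coord_space m)" using \<nu> by (simp add: orthogonally_invariant_def)
    have "decseq B"
      unfolding decseq_def B_def
    proof (safe)
      fix k l x i assume "k \<le> l" "\<forall>i<m. x i \<le> c i + 1 / real (Suc l)" "i < m"
      then have "x i \<le> c i + 1 / real (Suc l)" by simp
      also have "1 / real (Suc l) \<le> 1 / real (Suc k)" using \<open>k \<le> l\<close> by (simp add: field_simps)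
      finally show "x i \<le> c i + 1 / real (Suc k)" by simp
    qed
    then have "(\<lambda>k. emeasure \<nu> (B k)) \<longlonglongrightarrow> emeasure \<nu> (\<Inter>k. B k)"
      by (intro Lim_emeasure_decseq) (auto simp: sets)
    also have "(\<Inter>k. B k) = {x\<in>space (coord_space m). \<forall>i<m. x i \<le> c i}"
    proof (intro equalityI subsetI)
      fix x assume x: "x \<in> (\<Inter>k. B k)"
      have "x i \<le> c i" if "i < m" for i
      proof (rule field_le_epsilon)
        fix e :: real assume "e > 0"
        then obtain k where "1 / real (Suc k) < e" using nat_approx_posE by (metis)
        moreover have "x i \<le> c i + 1 / real (Suc k)" using x that by (auto simp: B_def)
        ultimately show "x i \<le> c i + e" by linarith
      qed
      then show "x \<in> {x\<in>space (coord_space m). \<forall>i<m. x i \<le> c i}" using x by (auto simp: B_def)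
    next
      fix x assume x: "x \<in> {x\<in>space (coord_space m). \<forall>i<m. x i \<le> c i}"
      have "x i \<le> c i + 1 / real (Suc k)" if "i < m" for i k
        using x that by (auto intro: add_increasing2)
      with x show "x \<in> (\<Inter>k. B k)" by (auto simp: B_def)
    qed
    finally show ?thesis
      by (rule LIMSEQ_le_const) (auto simp: B_def intro!: exI orthant_measure_le[OF \<mu> \<nu>])
  qed
  show ?thesis
    by (intro antisym le \<mu> \<nu>)
qed

text \<open>The orthants \<open>{x. \<forall>i<m. x i \<le> c i}\<close> form a generator of the product algebra that is closed under
  intersection.\<close>

theorem sphere_measure_unique:
  assumes \<mu>: "prob_space \<mu>" "orthogonally_invariant m \<mu>" "AE x in \<mu>. (\<Sum>i<m. (x i)\<^sup>2) = 1"
    and \<nu>: "prob_space \<nu>" "orthogonally_invariant m \<nu>" "AE x in \<nu>. (\<Sum>i<m. (x i)\<^sup>2) = 1"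
  shows "\<mu> = \<nu>"
proof -
  define G where "G = {{f\<in>(\<Pi>\<^sub>E i\<in>{..<m}. UNIV). \<forall>i\<in>{..<m}. f i \<in> A i} | A. A \<in> Pi {..<m} (\<lambda>_. range (\<lambda>a::real. {..a}))}"
  define orth where "orth c = {x\<in>space (coord_space m). \<forall>i<m. x i \<le> c i}" for c
  have G: "G = range orth"
  proof (intro equalityI subsetI)
    fix X assume "X \<in> G"
    then obtain A where A: "X = {f\<in>(\<Pi>\<^sub>E i\<in>{..<m}. UNIV). \<forall>i\<in>{..<m}. f i \<in> A i}"
      "A \<in> Pi {..<m} (\<lambda>_. range (\<lambda>a::real. {..a}))" unfolding G_def by blast
    then have "\<forall>i\<in>{..<m}. \<exists>a. A i = {..a}" by blast
    then obtain c where "\<forall>i\<in>{..<m}. A i = {..c i}" by metis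
    with A(1) have "X = orth c" by (auto simp: orth_def space_PiM)
    then show "X \<in> range orth" by blast
  next
    fix X assume "X \<in> range orth"
    then obtain c where "X = orth c" by blast
    then have "X = {f\<in>(\<Pi>\<^sub>E i\<in>{..<m}. UNIV). \<forall>i\<in>{..<m}. f i \<in> {..c i}}"
      by (auto simp: orth_def space_PiM)
    moreover have "(\<lambda>i. {..c i}) \<in> Pi {..<m} (\<lambda>_. range (\<lambda>a::real. {..a}))"
      by simp
    ultimately show "X \<in> G" unfolding G_def mem_Collect_eq by (intro exI conjI)
  qed
  have cover: "\<exists>S\<subseteq>range (\<lambda>a::real. {..a}). countable S \<and> UNIV = \<Union>S"
  proof (intro exI conjI)
    show "range (\<lambda>n::nat. {..real n}) \<subseteq> range (\<lambda>a::real. {..a})" by auto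
    show "UNIV = \<Union>(range (\<lambda>n::nat. {..real n}))" using real_arch_simple by auto
  qed auto
  have "sets (coord_space m) = sets (\<Pi>\<^sub>M i\<in>{..<m}. sigma UNIV (range (\<lambda>a::real. {..a})))"
    by (intro sets_PiM_cong) (auto simp: borel_eq_atMost)
  also have "\<dots> = sets (sigma (\<Pi>\<^sub>E i\<in>{..<m}. UNIV) {{f\<in>(\<Pi>\<^sub>E i\<in>{..<m}. UNIV). \<forall>i\<in>j. f i \<in> A i} | A j. j \<in> {{..<m}} \<and> A \<in> Pi j (\<lambda>_. range (\<lambda>a::real. {..a}))})"
    by (rule sets_PiM_sigma) (use cover in auto)
  also have "\<dots> = sigma_sets (\<Pi>\<^sub>E i\<in>{..<m}. UNIV) G"
    by (simp add: G_def) (subst sets_measure_of, auto)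
  finally have gen: "sets (coord_space m) = sigma_sets (space (coord_space m)) (range orth)"
    by (simp add: G space_PiM)
  show ?thesis
  proof (rule measure_eqI_generator_eq[where E = "range orth" and \<Omega> = "space (coord_space m)" and A = "\<lambda>k. orth (\<lambda>_. real k)"])
    show "Int_stable (range orth)"
    proof (rule Int_stableI_image)
      fix c d
      have "orth c \<inter> orth d = orth (\<lambda>i. min (c i) (d i))" by (auto simp: orth_def)
      then show "\<exists>k\<in>UNIV. orth c \<inter> orth d = orth k" by blast
    qed
    show "range orth \<subseteq> Pow (space (coord_space m))" by (auto simp: orth_def)
    show "emeasure \<mu> X = emeasure \<nu> X" if "X \<in> range orth" for X
      using that orthant_measure_eq[OF assms] by (auto simp: orth_def)
    show "sets \<mu> = sigma_sets (space (coord_space m)) (range orth)"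
      using \<mu>(2) gen by (simp add: orthogonally_invariant_def)
    show "sets \<nu> = sigma_sets (space (coord_space m)) (range orth)"
      using \<nu>(2) gen by (simp add: orthogonally_invariant_def)
    show "range (\<lambda>k. orth (\<lambda>_. real k)) \<subseteq> range orth" by auto
    show "(\<Union>k. orth (\<lambda>_. real k)) = space (coord_space m)"
    proof -
      have "\<exists>k. \<forall>i<m. x i \<le> real k" for x :: "nat \<Rightarrow> real"
      proof -
        obtain k :: nat where "Max (insert 0 (x ` {..<m})) \<le> real k" using real_arch_simple by blast
        then show ?thesis by (auto intro!: exI[of _ k])
      qed
      then show ?thesis by (auto simp: orth_def)
    qed
    show "emeasure \<mu> (orth (\<lambda>_. real k)) \<noteq> \<infinity>" for k
      using prob_space.emeasure_le_1[OF \<mu>(1), of "orth (\<lambda>_. real k)"] by (auto simp: top_unique)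
  qed
qed

definition normalize_vec :: "nat \<Rightarrow> (nat \<Rightarrow> real) \<Rightarrow> nat \<Rightarrow> real" where
  "normalize_vec m x = (\<lambda>i\<in>{..<m}. x i / sqrt (\<Sum>i<m. (x i)\<^sup>2))"

lemma measurable_normalize_vec [measurable]:
  "normalize_vec m \<in> measurable (coord_space m) (coord_space m)"
  unfolding normalize_vec_def by measurable

lemma orthogonally_invariant_normalize:
  assumes "orthogonally_invariant m \<mu>"
  shows "orthogonally_invariant m (distr \<mu> (coord_space m) (normalize_vec m))"
  unfolding orthogonally_invariant_def
proof (intro conjI allI impI)
  fix Q assume Q: "orthogonal_mat m Q"
  have [measurable_cong]: "sets \<mu> = sets (coord_space m)"
    using assms by (simp add: orthogonally_invariant_def)
  have comm: "mat_act m Q (normalize_vec m x) = normalize_vec m (mat_act m Q x)" for x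
  proof
    fix i
    have "mat_act m Q (normalize_vec m x) i = (if i < m then (\<Sum>j<m. Q $$ (i, j) * x j) / sqrt (\<Sum>i<m. (x i)\<^sup>2) else undefined)"
      by (simp add: mat_act_def normalize_vec_def sum_divide_distrib)
    also have "\<dots> = normalize_vec m (mat_act m Q x) i"
      unfolding normalize_vec_def[of m "mat_act m Q x"] sum_sq_mat_act[OF Q]
      by (simp add: mat_act_def)
    finally show "mat_act m Q (normalize_vec m x) i = normalize_vec m (mat_act m Q x) i" .
  qed
  have "distr (distr \<mu> (coord_space m) (normalize_vec m)) (coord_space m) (mat_act m Q)
      = distr (distr \<mu> (coord_space m) (mat_act m Q)) (coord_space m) (normalize_vec m)"
    by (simp add: distr_distr comp_def comm)
  also have "\<dots> = distr \<mu> (coord_space m) (normalize_vec m)"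
    using assms Q by (simp add: orthogonally_invariant_def)
  finally show "distr (distr \<mu> (coord_space m) (normalize_vec m)) (coord_space m) (mat_act m Q) = \<dots>" .
qed simp

lemma sum_sq_normalize_vec:
  assumes "(\<Sum>i<m. (x i)\<^sup>2) \<noteq> 0"
  shows "(\<Sum>i<m. (normalize_vec m x i)\<^sup>2) = 1"
proof -
  have "(\<Sum>i<m. (x i)\<^sup>2) \<ge> 0" by (intro sum_nonneg) auto
  with assms show ?thesis
    by (simp add: normalize_vec_def power_divide sum_divide_distrib[symmetric])
qed

text \<open>Normalising commutes with orthogonal maps, so the normalised laws are invariant measures on the
  unit sphere.\<close>

theorem directional_law_unique:
  assumes \<mu>: "prob_space \<mu>" "orthogonally_invariant m \<mu>" "AE x in \<mu>. (\<Sum>i<m. (x i)\<^sup>2) \<noteq> 0"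
    and \<nu>: "prob_space \<nu>" "orthogonally_invariant m \<nu>" "AE x in \<nu>. (\<Sum>i<m. (x i)\<^sup>2) \<noteq> 0"
  shows "distr \<mu> (coord_space m) (normalize_vec m) = distr \<nu> (coord_space m) (normalize_vec m)"
proof -
  have [measurable_cong]: "sets \<mu> = sets (coord_space m)" "sets \<nu> = sets (coord_space m)"
    using \<mu>(2) \<nu>(2) by (simp_all add: orthogonally_invariant_def)
  have "AE x in \<mu>. (\<Sum>i<m. (normalize_vec m x i)\<^sup>2) = 1" "AE x in \<nu>. (\<Sum>i<m. (normalize_vec m x i)\<^sup>2) = 1"
    using \<mu>(3) \<nu>(3) by (auto elim!: eventually_mono intro: sum_sq_normalize_vec)
  then show ?thesis
    by (intro sphere_measure_unique[of _ m] orthogonally_invariant_normalize \<mu> \<nu> prob_space.prob_space_distr)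
       (simp_all add: AE_distr_iff)
qed

section \<open>Polar coordinates and radial densities\<close>

lemma lborel_complex_eq:
  "(lborel :: complex measure) = distr (lborel \<Otimes>\<^sub>M lborel) borel (\<lambda>(x, y). Complex x y)"
proof (rule lborel_eqI)
  fix l u :: complex
  assume le: "\<And>b. b \<in> Basis \<Longrightarrow> l \<bullet> b \<le> u \<bullet> b"
  have [measurable]: "(\<lambda>(x, y). Complex x y) \<in> borel_measurable (lborel \<Otimes>\<^sub>M lborel)"
    unfolding Complex_eq by measurable
  have ri: "Re l \<le> Re u" "Im l \<le> Im u" using le[of 1] le[of \<i>] by (auto simp: Basis_complex_def inner_complex_def)
  have "(\<lambda>(x, y). Complex x y) -` box l u \<inter> space (lborel \<Otimes>\<^sub>M lborel) = {Re l<..<Re u} \<times> {Im l<..<Im u}"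
    by (auto simp: box_def Basis_complex_def inner_complex_def space_pair_measure)
  then have "emeasure (distr (lborel \<Otimes>\<^sub>M lborel) borel (\<lambda>(x, y). Complex x y)) (box l u)
      = emeasure (lborel \<Otimes>\<^sub>M lborel) ({Re l<..<Re u} \<times> {Im l<..<Im u})"
    by (subst emeasure_distr) auto
  also have "\<dots> = ennreal (Re u - Re l) * ennreal (Im u - Im l)"
    using ri by (subst lborel.emeasure_pair_measure_Times) auto
  also have "\<dots> = (\<Prod>b\<in>Basis. (u - l) \<bullet> b)"
    using ri by (simp add: Basis_complex_def inner_complex_def ennreal_mult)
  finally show "emeasure (distr (lborel \<Otimes>\<^sub>M lborel) borel (\<lambda>(x, y). Complex x y)) (box l u) = (\<Prod>b\<in>Basis. (u - l) \<bullet> b)" .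
qed simp

lemma nn_integral_lborel_complex:
  assumes [measurable]: "F \<in> borel_measurable borel"
  shows "(\<integral>\<^sup>+z. F z \<partial>lborel) = (\<integral>\<^sup>+x. \<integral>\<^sup>+y. F (Complex x y) \<partial>lborel \<partial>lborel)"
proof -
  have [measurable]: "(\<lambda>(x, y). Complex x y) \<in> borel_measurable (lborel \<Otimes>\<^sub>M lborel)"
    unfolding Complex_eq by measurable
  have "(\<integral>\<^sup>+z. F z \<partial>lborel) = (\<integral>\<^sup>+p. F (case p of (x, y) \<Rightarrow> Complex x y) \<partial>(lborel \<Otimes>\<^sub>M lborel))"
    by (subst lborel_complex_eq) (simp add: nn_integral_distr)
  also have "\<dots> = (\<integral>\<^sup>+x. \<integral>\<^sup>+y. F (Complex x y) \<partial>lborel \<partial>lborel)"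
    by (subst lborel.nn_integral_fst[symmetric]) auto
  finally show ?thesis .
qed

text \<open>A translation by a multiple of the period moves the left end point into \<open>[0, 2\<pi>)\<close>; then the part of
  the interval beyond \<open>2\<pi>\<close> is moved back by one period.\<close>

lemma nn_integral_periodic_shift:
  fixes H :: "real \<Rightarrow> ennreal"
  assumes [measurable]: "H \<in> borel_measurable borel" and per: "\<And>t. H (t + 2 * pi) = H t"
  shows "(\<integral>\<^sup>+t. H t * indicator {a<..a + 2 * pi} t \<partial>lborel) = (\<integral>\<^sup>+t. H t * indicator {0<..2 * pi} t \<partial>lborel)"
proof -
  have shift: "(\<integral>\<^sup>+t. f t \<partial>lborel) = (\<integral>\<^sup>+t. f (c + t) \<partial>lborel)"
    if "f \<in> borel_measurable borel" for f :: "real \<Rightarrow> ennreal" and c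
    using nn_integral_real_affine[OF that, of 1 c] by simp
  have pern: "H (t + 2 * pi * real n) = H t" for t n
  proof (induction n)
    case (Suc n)
    have "H (t + 2 * pi * real (Suc n)) = H ((t + 2 * pi * real n) + 2 * pi)" by (simp add: algebra_simps)
    then show ?case using per Suc by simp
  qed simp
  have peri: "H (t + 2 * pi * of_int k) = H t" for t k
  proof (cases "k \<ge> 0")
    case True then show ?thesis using pern[of t "nat k"] by simp
  next
    case False then show ?thesis using pern[of "t + 2 * pi * of_int k" "nat (-k)"] by simp
  qed
  define k where "k = \<lfloor>a / (2 * pi)\<rfloor>"
  define b where "b = a - 2 * pi * of_int k"
  have b: "0 \<le> b" "b < 2 * pi"
    using floor_divide_lower[of "2 * pi" a] floor_divide_upper[of "2 * pi" a]
    unfolding b_def k_def by (simp_all add: algebra_simps)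
  have "(\<integral>\<^sup>+t. H t * indicator {a<..a + 2 * pi} t \<partial>lborel)
      = (\<integral>\<^sup>+t. H (2 * pi * of_int k + t) * indicator {a<..a + 2 * pi} (2 * pi * of_int k + t) \<partial>lborel)"
    by (rule shift) measurable
  also have "\<dots> = (\<integral>\<^sup>+t. H t * indicator {b<..b + 2 * pi} t \<partial>lborel)"
    by (intro nn_integral_cong) (auto simp: b_def peri add.commute[of "2 * pi * of_int k"] split: split_indicator)
  also have "\<dots> = (\<integral>\<^sup>+t. H t * indicator {b<..2 * pi} t + H t * indicator {2 * pi<..b + 2 * pi} t \<partial>lborel)"
    using b by (intro nn_integral_cong) (auto split: split_indicator)
  also have "\<dots> = (\<integral>\<^sup>+t. H t * indicator {b<..2 * pi} t \<partial>lborel) + (\<integral>\<^sup>+t. H t * indicator {2 * pi<..b + 2 * pi} t \<partial>lborel)"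
    by (rule nn_integral_add) measurable
  also have "(\<integral>\<^sup>+t. H t * indicator {2 * pi<..b + 2 * pi} t \<partial>lborel)
      = (\<integral>\<^sup>+t. H (2 * pi + t) * indicator {2 * pi<..b + 2 * pi} (2 * pi + t) \<partial>lborel)"
    by (rule shift) measurable
  also have "\<dots> = (\<integral>\<^sup>+t. H t * indicator {0<..b} t \<partial>lborel)"
    using per by (intro nn_integral_cong) (auto simp: add.commute[of "2 * pi"] split: split_indicator)
  also have "(\<integral>\<^sup>+t. H t * indicator {b<..2 * pi} t \<partial>lborel) + (\<integral>\<^sup>+t. H t * indicator {0<..b} t \<partial>lborel)
      = (\<integral>\<^sup>+t. H t * indicator {b<..2 * pi} t + H t * indicator {0<..b} t \<partial>lborel)"
    by (rule nn_integral_add[symmetric]) measurable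
  also have "\<dots> = (\<integral>\<^sup>+t. H t * indicator {0<..2 * pi} t \<partial>lborel)"
    using b by (intro nn_integral_cong) (auto split: split_indicator)
  finally show ?thesis .
qed

lemma borel_measurable_tan [measurable]: "(tan :: real \<Rightarrow> real) \<in> borel_measurable borel"
  unfolding tan_def by measurable

text \<open>Substitution on the compact intervals \<open>[- a k, a k]\<close> with \<open>a k\<close> increasing to \<open>\<pi> / 2\<close>, followed by
  monotone convergence. It plays the role of the Jacobian in the passage to polar coordinates.\<close>

lemma nn_integral_tan_substitution:
  fixes f :: "real \<Rightarrow> ennreal"
  assumes [measurable]: "f \<in> borel_measurable borel" and c: "c > 0"
  shows "(\<integral>\<^sup>+y. f y \<partial>lborel)
       = (\<integral>\<^sup>+t. f (c * tan t) * ennreal (c / (cos t)\<^sup>2) * indicator {-pi/2<..<pi/2} t \<partial>lborel)"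
proof -
  define a where "a k = pi / 2 - 1 / real (Suc k)" for k
  have a: "0 < a k" "a k < pi / 2" for k
  proof -
    have "1 / real (Suc k) \<le> 1" by simp
    then show "0 < a k" using pi_gt3 unfolding a_def by linarith
  qed (simp add: a_def)
  have a_mono: "a k \<le> a l" if "k \<le> l" for k l
    using that by (simp add: a_def field_simps)
  have ex: "\<exists>k. t \<le> a k" if "t < pi / 2" for t
  proof -
    have "0 < pi / 2 - t" using that by simp
    then obtain k where "1 / real (Suc k) < pi / 2 - t" by (rule nat_approx_posE)
    then show ?thesis by (intro exI[of _ k]) (simp add: a_def)
  qed
  define I where "I k = {c * tan (- a k)..c * tan (a k)}" for k
  define J where "J k = {- a k..a k}" for k
  have tan_mono: "tan s \<le> tan t" if "s \<le> t" "- (pi / 2) < s" "t < pi / 2" for s t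
    using that tan_mono_le by (metis less_eq_real_def)
  have I: "incseq I" "(\<Union>k. I k) = UNIV"
  proof -
    have "tan (- a l) \<le> tan (- a k)" "tan (a k) \<le> tan (a l)" if "k \<le> l" for k l
      using that a[of k] a[of l] a_mono[OF that] by (auto intro!: tan_mono simp del: tan_minus)
    then show "incseq I" unfolding I_def incseq_def using c
      by (auto intro: order_trans[OF _ mult_left_mono] order_trans[OF mult_left_mono])
    have "y \<in> (\<Union>k. I k)" for y
    proof -
      define t where "t = arctan (\<bar>y\<bar> / c)"
      have t: "t < pi / 2" "0 \<le> t" "tan t = \<bar>y\<bar> / c" using c arctan_ubound[of "\<bar>y\<bar> / c"] by (simp_all add: t_def tan_arctan)
      then obtain k where k: "t \<le> a k" using ex by blast
      then have "tan t \<le> tan (a k)" using t a[of k] by (intro tan_mono) auto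
      then have "\<bar>y\<bar> \<le> c * tan (a k)" using t c by (simp add: field_simps)
      then have "y \<in> I k" by (auto simp: I_def)
      then show ?thesis by blast
    qed
    then show "(\<Union>k. I k) = UNIV" by blast
  qed
  have J: "incseq J" "(\<Union>k. J k) = {-pi/2<..<pi/2}"
  proof -
    show "incseq J" unfolding J_def incseq_def using a_mono by fastforce
    show "(\<Union>k. J k) = {-pi/2<..<pi/2}"
    proof (intro equalityI subsetI)
      fix t assume "t \<in> {-pi/2<..<pi/2}"
      then have "\<bar>t\<bar> < pi / 2" by auto
      then obtain k where "\<bar>t\<bar> \<le> a k" using ex by blast
      then have "t \<in> J k" by (auto simp: J_def)
      then show "t \<in> (\<Union>k. J k)" by blast
    next
      fix t assume "t \<in> (\<Union>k. J k)"
      then obtain k where "t \<in> J k" by blast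
      then show "t \<in> {-pi/2<..<pi/2}" using a[of k] by (auto simp: J_def)
    qed
  qed
  define g where "g t = f (c * tan t) * ennreal (c / (cos t)\<^sup>2)" for t
  have [measurable]: "g \<in> borel_measurable borel" unfolding g_def by measurable
  have eq: "emeasure (density lborel f) (I k) = emeasure (density lborel g) (J k)" for k
  proof -
    have cos0: "cos t \<noteq> 0" if "t \<in> {-a k..a k}" for t
      using that a[of k] cos_gt_zero_pi[of t] by auto
    have "(\<integral>\<^sup>+y. f y * indicator {c * tan (- a k)..c * tan (a k)} y \<partial>lborel)
        = (\<integral>\<^sup>+t. f (c * tan t) * ennreal (c / (cos t)\<^sup>2) * indicator {- a k..a k} t \<partial>lborel)"
    proof (rule nn_integral_substitution_aux)
      show "((\<lambda>t. c * tan t) has_real_derivative c / (cos t)\<^sup>2) (at t)" if "t \<in> {- a k..a k}" for t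
        using cos0[OF that] by (auto intro!: derivative_eq_intros simp: field_simps)
      show "continuous_on {- a k..a k} (\<lambda>t. c / (cos t)\<^sup>2)"
        using cos0 by (intro continuous_intros) auto
    qed (use c a[of k] in auto)
    then show ?thesis unfolding I_def J_def by (subst (1 2) emeasure_density) (auto simp: g_def)
  qed
  have "(\<integral>\<^sup>+y. f y \<partial>lborel) = emeasure (density lborel f) (\<Union>k. I k)"
    by (subst emeasure_density) (auto simp: I)
  also have "\<dots> = (SUP k. emeasure (density lborel f) (I k))"
  proof -
    have "range I \<subseteq> sets (density lborel f)" by (auto simp: I_def)
    from this I(1) show ?thesis by (rule SUP_emeasure_incseq[symmetric])
  qed
  also have "\<dots> = (SUP k. emeasure (density lborel g) (J k))"
    by (simp add: eq)
  also have "\<dots> = emeasure (density lborel g) (\<Union>k. J k)"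
  proof -
    have "range J \<subseteq> sets (density lborel g)" by (auto simp: J_def)
    then show ?thesis using J(1) by (rule SUP_emeasure_incseq)
  qed
  also have "\<dots> = (\<integral>\<^sup>+t. g t * indicator {-pi/2<..<pi/2} t \<partial>lborel)"
    by (subst emeasure_density) (auto simp: J)
  finally show ?thesis by (simp add: g_def)
qed

text \<open>For fixed \<open>x > 0\<close> substitute \<open>y = x tan t\<close>, exchange the integrals, and then substitute
  \<open>x = r cos t\<close> for fixed \<open>t\<close>. The two factors \<open>x / (cos t)\<^sup>2\<close> and \<open>cos t\<close> multiply to \<open>r\<close>.\<close>

lemma nn_integral_right_half_plane:
  fixes F :: "complex \<Rightarrow> ennreal"
  assumes [measurable]: "F \<in> borel_measurable borel"
  shows "(\<integral>\<^sup>+x. indicator {0<..} x * (\<integral>\<^sup>+y. F (Complex x y) \<partial>lborel) \<partial>lborel)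
    = (\<integral>\<^sup>+t. indicator {-pi/2<..<pi/2} t * (\<integral>\<^sup>+r. indicator {0<..} r * (ennreal r * F (rcis r t)) \<partial>lborel) \<partial>lborel)"
proof -
  have [measurable]: "(\<lambda>(x, y). Complex x y) \<in> borel_measurable (lborel \<Otimes>\<^sub>M lborel)"
    "(\<lambda>(x, y). Complex x y) \<in> borel_measurable (borel \<Otimes>\<^sub>M borel)"
    unfolding Complex_eq by measurable
  have rc: "rcis r t = Complex (r * cos t) (r * sin t)" for r t
    by (simp add: complex_eq_iff)
  have "(\<integral>\<^sup>+x. indicator {0<..} x * (\<integral>\<^sup>+y. F (Complex x y) \<partial>lborel) \<partial>lborel)
     = (\<integral>\<^sup>+x. \<integral>\<^sup>+t. indicator {0<..} x * (F (Complex x (x * tan t)) * ennreal (x / (cos t)\<^sup>2) * indicator {-pi/2<..<pi/2} t) \<partial>lborel \<partial>lborel)"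
  proof (intro nn_integral_cong)
    fix x :: real
    show "indicator {0<..} x * (\<integral>\<^sup>+y. F (Complex x y) \<partial>lborel) =
      (\<integral>\<^sup>+t. indicator {0<..} x * (F (Complex x (x * tan t)) * ennreal (x / (cos t)\<^sup>2) * indicator {-pi/2<..<pi/2} t) \<partial>lborel)"
    proof (cases "x > 0")
      case True
      have [measurable]: "(\<lambda>y. F (Complex x y)) \<in> borel_measurable borel" unfolding Complex_eq by measurable
      show ?thesis using True nn_integral_tan_substitution[of "\<lambda>y. F (Complex x y)" x] by simp
    qed simp
  qed
  also have "\<dots> = (\<integral>\<^sup>+t. \<integral>\<^sup>+x. indicator {0<..} x * (F (Complex x (x * tan t)) * ennreal (x / (cos t)\<^sup>2) * indicator {-pi/2<..<pi/2} t) \<partial>lborel \<partial>lborel)"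
    unfolding Complex_eq by (rule lborel_pair.Fubini'[symmetric]) measurable
  also have "\<dots> = (\<integral>\<^sup>+t. indicator {-pi/2<..<pi/2} t * (\<integral>\<^sup>+r. indicator {0<..} r * (ennreal r * F (rcis r t)) \<partial>lborel) \<partial>lborel)"
  proof (intro nn_integral_cong)
    fix t :: real
    show "(\<integral>\<^sup>+x. indicator {0<..} x * (F (Complex x (x * tan t)) * ennreal (x / (cos t)\<^sup>2) * indicator {-pi/2<..<pi/2} t) \<partial>lborel)
      = indicator {-pi/2<..<pi/2} t * (\<integral>\<^sup>+r. indicator {0<..} r * (ennreal r * F (rcis r t)) \<partial>lborel)"
    proof (cases "t \<in> {-pi/2<..<pi/2}")
      case True
      then have ct: "cos t > 0" using cos_gt_zero_pi[of t] by auto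
      define f where "f x = indicator {0<..} x * (F (Complex x (x * tan t)) * ennreal (x / (cos t)\<^sup>2))" for x
      have [measurable]: "f \<in> borel_measurable borel" unfolding f_def Complex_eq by measurable
      have "(\<integral>\<^sup>+x. f x \<partial>lborel) = ennreal \<bar>cos t\<bar> * (\<integral>\<^sup>+r. f (0 + cos t * r) \<partial>lborel)"
        using ct by (intro nn_integral_real_affine) auto
      also have "\<dots> = (\<integral>\<^sup>+r. ennreal \<bar>cos t\<bar> * f (0 + cos t * r) \<partial>lborel)"
        by (rule nn_integral_cmult[symmetric]) measurable
      also have "\<dots> = (\<integral>\<^sup>+r. indicator {0<..} r * (ennreal r * F (rcis r t)) \<partial>lborel)"
      proof (intro nn_integral_cong)
        fix r :: real
        show "ennreal \<bar>cos t\<bar> * f (0 + cos t * r) = indicator {0<..} r * (ennreal r * F (rcis r t))"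
        proof (cases "r > 0")
          case r: True
          have "cos t * r * tan t = r * sin t" using ct by (simp add: tan_def)
          then have "ennreal \<bar>cos t\<bar> * f (0 + cos t * r) = ennreal (cos t) * ennreal (cos t * r / (cos t)\<^sup>2) * F (rcis r t)"
            using r ct by (simp add: f_def rc mult_ac)
          also have "ennreal (cos t) * ennreal (cos t * r / (cos t)\<^sup>2) = ennreal r"
            using ct r by (subst ennreal_mult[symmetric]) (auto simp: power2_eq_square)
          finally show ?thesis using r by simp
        next
          case r: False
          then have "\<not> 0 < cos t * r" using ct by (simp add: zero_less_mult_iff)
          then show ?thesis using r by (simp add: f_def)
        qed
      qed
      finally show ?thesis using True by (simp add: f_def)
    qed simp
  qed
  finally show ?thesis .
qed

lemma borel_measurable_rcis [measurable]: "(\<lambda>(r, t). rcis r t) \<in> borel_measurable (borel \<Otimes>\<^sub>M borel)"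
  unfolding rcis_def cis_conv_exp by measurable

text \<open>The left half plane is the image of the right one under negation, which adds \<open>\<pi>\<close> to the angle;
  the imaginary axis is a null set.\<close>

theorem nn_integral_polar:
  fixes F :: "complex \<Rightarrow> ennreal"
  assumes [measurable]: "F \<in> borel_measurable borel"
  shows "(\<integral>\<^sup>+z. F z \<partial>lborel)
    = (\<integral>\<^sup>+t. indicator {0<..2 * pi} t * (\<integral>\<^sup>+r. indicator {0<..} r * (ennreal r * F (rcis r t)) \<partial>lborel) \<partial>lborel)"
proof -
  have [measurable]: "(\<lambda>(x, y). Complex x y) \<in> borel_measurable (lborel \<Otimes>\<^sub>M lborel)"
    "(\<lambda>(x, y). Complex x y) \<in> borel_measurable (borel \<Otimes>\<^sub>M borel)"
    unfolding Complex_eq by measurable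
  define H where "H t = (\<integral>\<^sup>+r. indicator {0<..} r * (ennreal r * F (rcis r t)) \<partial>lborel)" for t
  have [measurable]: "H \<in> borel_measurable borel" unfolding H_def by measurable
  have per: "H (t + 2 * pi) = H t" for t
    by (simp add: H_def rcis_def cis.ctr)
  define Y where "Y x = (\<integral>\<^sup>+y. F (Complex x y) \<partial>lborel)" for x
  have [measurable]: "Y \<in> borel_measurable borel" unfolding Y_def Complex_eq by measurable
  have "(\<integral>\<^sup>+z. F z \<partial>lborel) = (\<integral>\<^sup>+x. Y x \<partial>lborel)"
    unfolding Y_def by (rule nn_integral_lborel_complex) measurable
  also have "\<dots> = (\<integral>\<^sup>+x. indicator {0<..} x * Y x + indicator {..<0} x * Y x \<partial>lborel)"
    by (intro nn_integral_cong_AE, use AE_lborel_singleton[of 0] in eventually_elim)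
       (auto split: split_indicator)
  also have "\<dots> = (\<integral>\<^sup>+x. indicator {0<..} x * Y x \<partial>lborel) + (\<integral>\<^sup>+x. indicator {..<0} x * Y x \<partial>lborel)"
    by (rule nn_integral_add) measurable
  also have "(\<integral>\<^sup>+x. indicator {0<..} x * Y x \<partial>lborel) = (\<integral>\<^sup>+t. indicator {-pi/2<..<pi/2} t * H t \<partial>lborel)"
    unfolding Y_def H_def by (rule nn_integral_right_half_plane) measurable
  also have "(\<integral>\<^sup>+x. indicator {..<0} x * Y x \<partial>lborel) = (\<integral>\<^sup>+x. indicator {..<0} (-x) * Y (-x) \<partial>lborel)"
    using nn_integral_real_affine[of "\<lambda>x. indicator {..<0} x * Y x" "-1" 0] by simp
  also have "\<dots> = (\<integral>\<^sup>+x. indicator {0<..} x * (\<integral>\<^sup>+y. F (- Complex x y) \<partial>lborel) \<partial>lborel)"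
  proof (intro nn_integral_cong)
    fix x :: real
    have [measurable]: "(\<lambda>y. F (Complex (-x) y)) \<in> borel_measurable borel" unfolding Complex_eq by measurable
    have "Y (-x) = (\<integral>\<^sup>+y. F (- Complex x y) \<partial>lborel)"
      using nn_integral_real_affine[of "\<lambda>y. F (Complex (-x) y)" "-1" 0] by (simp add: Y_def complex_minus)
    then show "indicator {..<0} (-x) * Y (-x) = indicator {0<..} x * (\<integral>\<^sup>+y. F (- Complex x y) \<partial>lborel)"
      by (auto split: split_indicator)
  qed
  also have "\<dots> = (\<integral>\<^sup>+t. indicator {-pi/2<..<pi/2} t * (\<integral>\<^sup>+r. indicator {0<..} r * (ennreal r * F (- rcis r t)) \<partial>lborel) \<partial>lborel)"
    by (rule nn_integral_right_half_plane) measurable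
  also have "\<dots> = (\<integral>\<^sup>+t. indicator {-pi/2<..<pi/2} t * H (t + pi) \<partial>lborel)"
  proof -
    have "rcis r (t + pi) = - rcis r t" for r t by (simp add: complex_eq_iff)
    then show ?thesis by (simp add: H_def)
  qed
  also have "\<dots> = (\<integral>\<^sup>+t. indicator {pi/2<..<3*pi/2} t * H t \<partial>lborel)"
    using nn_integral_real_affine[of "\<lambda>t. indicator {pi/2<..<3*pi/2} t * H t" 1 pi]
    by (simp add: add.commute) (intro nn_integral_cong, auto split: split_indicator)
  also have "(\<integral>\<^sup>+t. indicator {-pi/2<..<pi/2} t * H t \<partial>lborel) + (\<integral>\<^sup>+t. indicator {pi/2<..<3*pi/2} t * H t \<partial>lborel)
     = (\<integral>\<^sup>+t. indicator {-pi/2<..<pi/2} t * H t + indicator {pi/2<..<3*pi/2} t * H t \<partial>lborel)"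
    by (rule nn_integral_add[symmetric]) measurable
  also have "\<dots> = (\<integral>\<^sup>+t. H t * indicator {-pi/2<..-pi/2 + 2 * pi} t \<partial>lborel)"
    by (intro nn_integral_cong_AE, use AE_lborel_singleton[of "pi/2"] AE_lborel_singleton[of "3*pi/2"] in eventually_elim)
       (auto split: split_indicator)
  also have "\<dots> = (\<integral>\<^sup>+t. H t * indicator {0<..2 * pi} t \<partial>lborel)"
    by (rule nn_integral_periodic_shift) (auto simp: per)
  finally show ?thesis by (simp add: H_def mult.commute)
qed

text \<open>Averaging the invariance over all rotations gives \<open>2\<pi> \<kappa>(B) = \<integral> w(\<bar>z\<bar>) d\<kappa>\<close>, where \<open>w r\<close> is the
  measure of the set of angles \<open>t\<close> for which \<open>rcis r t \<in> B\<close>. If \<open>G\<close> is the density of the modulus, then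
  this is \<open>\<integral> G(r) w(r) dr\<close>, which polar coordinates turn into the integral over \<open>B\<close> of
  \<open>G(\<bar>z\<bar>) / \<bar>z\<bar>\<close>.\<close>

lemma rotation_invariant_radial_density:
  fixes \<kappa> :: "complex measure"
  assumes pr: "prob_space \<kappa>" and s: "sets \<kappa> = sets borel"
    and rot: "\<And>l B. cmod l = 1 \<Longrightarrow> B \<in> sets borel \<Longrightarrow> emeasure \<kappa> ((*) l -` B) = emeasure \<kappa> B"
    and rad: "\<And>R. R \<in> null_sets (lborel :: real measure) \<Longrightarrow> emeasure \<kappa> {z. cmod z \<in> R} = 0"
  obtains g :: "real \<Rightarrow> real" where "g \<in> borel_measurable borel" "\<And>r. 0 \<le> g r"
    "\<kappa> = density lborel (\<lambda>z. ennreal (g (cmod z)))"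
    "(\<integral>\<^sup>+r. indicator {0<..} r * ennreal (r * g r) \<partial>lborel) = ennreal (1 / (2 * pi))"
proof -
  interpret prob_space \<kappa> by fact
  have [measurable_cong]: "sets \<kappa> = sets borel" by fact
  have sp [simp]: "space \<kappa> = UNIV" using sets_eq_imp_space_eq[OF s] by simp
  interpret kl: pair_sigma_finite \<kappa> "lborel :: real measure" ..
  define D where "D = distr \<kappa> borel cmod"
  have Dsets [simp, measurable_cong]: "sets D = sets borel" by (simp add: D_def)
  have Dem: "emeasure D R = emeasure \<kappa> {z. cmod z \<in> R}" if "R \<in> sets borel" for R
    unfolding D_def using that by (subst emeasure_distr) (auto simp: vimage_def)
  have "absolutely_continuous lborel D"
    unfolding absolutely_continuous_def
  proof
    fix R assume R: "R \<in> null_sets (lborel :: real measure)"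
    then have "R \<in> sets borel" by (auto simp: null_sets_def)
    with rad[OF R] show "R \<in> null_sets D" by (intro null_setsI) (auto simp: Dem)
  qed
  then obtain G where [measurable]: "G \<in> borel_measurable borel" and G: "density lborel G = D"
    using sigma_finite_measure.Radon_Nikodym[OF sigma_finite_lborel, of D] by auto
  have G1: "(\<integral>\<^sup>+r. G r \<partial>lborel) = 1"
  proof -
    have "(\<integral>\<^sup>+r. G r \<partial>lborel) = emeasure (density lborel G) UNIV"
      by (subst emeasure_density) auto
    also have "\<dots> = 1" unfolding G by (subst Dem) (use emeasure_space_1 in auto)
    finally show ?thesis .
  qed
  \<comment> \<open>\<open>G\<close> is determined almost everywhere only: it may be infinite or live on negative radii on a null set.\<close>
  have Gfin: "AE r in lborel. G r \<noteq> \<top>"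
    using nn_integral_noteq_infinite[of G lborel] G1 by simp
  have Gneg: "AE r in lborel. r < 0 \<longrightarrow> G r = 0"
  proof -
    have "(\<integral>\<^sup>+r. G r * indicator {..<0} r \<partial>lborel) = emeasure D {..<0}"
      unfolding G[symmetric] by (rule emeasure_density[symmetric]) auto
    also have "\<dots> = emeasure \<kappa> {}" by (subst Dem) (auto intro!: arg_cong[where f = "emeasure \<kappa>"])
    also have "\<dots> = 0" by simp
    finally have "AE r in lborel. G r * indicator {..<0} r = 0"
      by (subst (asm) nn_integral_0_iff_AE) auto
    then show ?thesis by eventually_elim (auto split: split_indicator)
  qed
  define g where "g r = (if 0 < r then enn2real (G r) / (2 * pi * r) else 0)" for r
  have gm [measurable]: "g \<in> borel_measurable borel" unfolding g_def by measurable
  have g0: "0 \<le> g r" for r by (simp add: g_def)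
  have gG: "AE r in lborel. ennreal (2 * pi) * (indicator {0<..} r * ennreal (r * g r)) = G r"
    using Gfin Gneg AE_lborel_singleton[of "0::real"]
  proof eventually_elim
    case (elim r)
    show ?case
    proof (cases "r > 0")
      case True
      have "ennreal (2 * pi) * ennreal (r * g r) = ennreal (2 * pi * (r * g r))"
        using True g0[of r] by (subst ennreal_mult) auto
      also have "2 * pi * (r * g r) = enn2real (G r)" using True by (simp add: g_def)
      also have "ennreal (enn2real (G r)) = G r" using elim(1) by (simp add: less_top)
      finally show ?thesis using True by simp
    qed (use elim in auto)
  qed
  have tot: "(\<integral>\<^sup>+r. indicator {0<..} r * ennreal (r * g r) \<partial>lborel) = ennreal (1 / (2 * pi))" (is "?I = _")
  proof -
    have "ennreal (2 * pi) * ?I = (\<integral>\<^sup>+r. ennreal (2 * pi) * (indicator {0<..} r * ennreal (r * g r)) \<partial>lborel)"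
      by (rule nn_integral_cmult[symmetric]) measurable
    also have "\<dots> = 1" using nn_integral_cong_AE[OF gG] G1 by simp
    finally have "ennreal (1 / (2 * pi)) * (ennreal (2 * pi) * ?I) = ennreal (1 / (2 * pi))" by simp
    moreover have "ennreal (1 / (2 * pi)) * ennreal (2 * pi) = 1"
      by (subst ennreal_mult[symmetric]) auto
    ultimately show ?thesis by (metis mult.assoc mult_1)
  qed
  have "\<kappa> = density lborel (\<lambda>z. ennreal (g (cmod z)))"
  proof (rule measure_eqI)
    fix B assume "B \<in> sets \<kappa>"
    then have B [measurable]: "B \<in> sets borel" by (simp add: s)
    define w :: "real \<Rightarrow> ennreal" where "w r = (\<integral>\<^sup>+t. indicator {0<..2 * pi} t * indicator B (rcis r t) \<partial>lborel)" for r
    have [measurable]: "w \<in> borel_measurable borel" unfolding w_def by measurable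
    have W: "(\<integral>\<^sup>+t. indicator {0<..2 * pi} t * indicator B (cis t * z) \<partial>lborel) = w (cmod z)" for z
    proof -
      define H :: "real \<Rightarrow> ennreal" where "H t = indicator B (rcis (cmod z) t)" for t
      have [measurable]: "H \<in> borel_measurable borel" unfolding H_def by measurable
      have per: "H (t + 2 * pi) = H t" for t by (simp add: H_def rcis_def cis.ctr)
      define a where "a = Arg z"
      have z: "cis t * z = rcis (cmod z) (a + t)" for t
        by (metis a_def cis_rcis_eq mult_1 rcis_cmod_Arg rcis_mult add.commute)
      have "(\<integral>\<^sup>+t. indicator {0<..2 * pi} t * indicator B (cis t * z) \<partial>lborel)
          = (\<integral>\<^sup>+t. H (a + t) * indicator {a<..a + 2 * pi} (a + t) \<partial>lborel)"
        by (intro nn_integral_cong) (auto simp: z H_def split: split_indicator)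
      also have "\<dots> = (\<integral>\<^sup>+t. H t * indicator {a<..a + 2 * pi} t \<partial>lborel)"
        using nn_integral_real_affine[of "\<lambda>t. H t * indicator {a<..a + 2 * pi} t" 1 a] by simp
      also have "\<dots> = (\<integral>\<^sup>+t. H t * indicator {0<..2 * pi} t \<partial>lborel)"
        by (rule nn_integral_periodic_shift) (auto simp: per)
      finally show ?thesis by (simp add: w_def H_def mult.commute)
    qed
    have "ennreal (2 * pi) * emeasure \<kappa> B = (\<integral>\<^sup>+t. emeasure \<kappa> B * indicator {0<..2 * pi} t \<partial>lborel)"
      by (subst nn_integral_cmult_indicator) (auto simp: mult.commute)
    also have "\<dots> = (\<integral>\<^sup>+t. \<integral>\<^sup>+z. indicator {0<..2 * pi} t * indicator B (cis t * z) \<partial>\<kappa> \<partial>lborel)"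
    proof (rule nn_integral_cong)
      fix t :: real
      have m: "(*) (cis t) -` B \<in> sets borel"
        using measurable_sets[of "(*) (cis t)" borel borel B] B by simp
      have "(\<integral>\<^sup>+z. indicator {0<..2 * pi} t * indicator B (cis t * z) \<partial>\<kappa>)
          = (\<integral>\<^sup>+z. indicator {0<..2 * pi} t * indicator ((*) (cis t) -` B) z \<partial>\<kappa>)"
        by (intro nn_integral_cong) (auto split: split_indicator)
      also have "\<dots> = indicator {0<..2 * pi} t * emeasure \<kappa> ((*) (cis t) -` B)"
        using m by (subst nn_integral_cmult_indicator) (auto simp: s)
      also have "\<dots> = indicator {0<..2 * pi} t * emeasure \<kappa> B"
        using rot[OF norm_cis B, of t] by simp
      finally show "emeasure \<kappa> B * indicator {0<..2 * pi} t = (\<integral>\<^sup>+z. indicator {0<..2 * pi} t * indicator B (cis t * z) \<partial>\<kappa>)"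
        by (simp add: mult.commute)
    qed
    also have "\<dots> = (\<integral>\<^sup>+z. \<integral>\<^sup>+t. indicator {0<..2 * pi} t * indicator B (cis t * z) \<partial>lborel \<partial>\<kappa>)"
      unfolding cis_conv_exp by (rule kl.Fubini') measurable
    also have "\<dots> = (\<integral>\<^sup>+z. w (cmod z) \<partial>\<kappa>)" by (simp add: W)
    also have "\<dots> = (\<integral>\<^sup>+r. w r \<partial>D)" unfolding D_def by (subst nn_integral_distr) auto
    also have "\<dots> = (\<integral>\<^sup>+r. G r * w r \<partial>lborel)" unfolding G[symmetric] by (rule nn_integral_density) measurable
    also have "\<dots> = (\<integral>\<^sup>+r. ennreal (2 * pi) * (indicator {0<..} r * ennreal (r * g r) * w r) \<partial>lborel)"
      by (intro nn_integral_cong_AE, use gG in eventually_elim) (simp add: mult.assoc[symmetric])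
    also have "\<dots> = ennreal (2 * pi) * (\<integral>\<^sup>+r. indicator {0<..} r * ennreal (r * g r) * w r \<partial>lborel)"
      by (rule nn_integral_cmult) measurable
    also have "(\<integral>\<^sup>+r. indicator {0<..} r * ennreal (r * g r) * w r \<partial>lborel)
        = (\<integral>\<^sup>+r. \<integral>\<^sup>+t. indicator {0<..} r * ennreal (r * g r) * (indicator {0<..2 * pi} t * indicator B (rcis r t)) \<partial>lborel \<partial>lborel)"
      unfolding w_def by (intro nn_integral_cong nn_integral_cmult[symmetric]) measurable
    also have "\<dots> = (\<integral>\<^sup>+t. \<integral>\<^sup>+r. indicator {0<..} r * ennreal (r * g r) * (indicator {0<..2 * pi} t * indicator B (rcis r t)) \<partial>lborel \<partial>lborel)"
      by (rule lborel_pair.Fubini'[symmetric]) measurable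
    also have "\<dots> = (\<integral>\<^sup>+t. indicator {0<..2 * pi} t * (\<integral>\<^sup>+r. indicator {0<..} r * (ennreal r * (ennreal (g (cmod (rcis r t))) * indicator B (rcis r t))) \<partial>lborel) \<partial>lborel)"
    proof (rule nn_integral_cong)
      fix t :: real
      have "indicator {0<..} r * ennreal (r * g r) * (indicator {0<..2 * pi} t * indicator B (rcis r t))
        = indicator {0<..2 * pi} t * (indicator {0<..} r * (ennreal r * (ennreal (g (cmod (rcis r t))) * indicator B (rcis r t))))" for r
        using g0[of r] by (cases "r > 0") (auto simp: ennreal_mult mult_ac split: split_indicator)
      then show "(\<integral>\<^sup>+r. indicator {0<..} r * ennreal (r * g r) * (indicator {0<..2 * pi} t * indicator B (rcis r t)) \<partial>lborel)
        = indicator {0<..2 * pi} t * (\<integral>\<^sup>+r. indicator {0<..} r * (ennreal r * (ennreal (g (cmod (rcis r t))) * indicator B (rcis r t))) \<partial>lborel)"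
        by (simp add: nn_integral_cmult)
    qed
    also have "\<dots> = (\<integral>\<^sup>+z. ennreal (g (cmod z)) * indicator B z \<partial>lborel)"
      by (rule nn_integral_polar[symmetric]) measurable
    also have "\<dots> = emeasure (density lborel (\<lambda>z. ennreal (g (cmod z)))) B"
      by (rule emeasure_density[symmetric]) auto
    finally show "emeasure \<kappa> B = emeasure (density lborel (\<lambda>z. ennreal (g (cmod z)))) B"
      by (simp add: ennreal_mult_cancel_left)
  qed (simp add: s)
  then show ?thesis using that gm g0 tot by blast
qed

text \<open>The Jacobian \<open>r\<close> vanishes for \<open>r = 0\<close> only, so planar null sets are null sets of polar coordinates.\<close>

lemma AE_polar:
  assumes P: "{z. P z} \<in> sets (borel :: complex measure)" and ae: "AE z in lborel. P z"
  shows "AE t in lborel. AE r in lborel. 0 < r \<longrightarrow> t \<in> {0<..2 * pi} \<longrightarrow> P (rcis r t)"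
    and "AE r in lborel. AE t in lborel. 0 < r \<longrightarrow> t \<in> {0<..2 * pi} \<longrightarrow> P (rcis r t)"
proof -
  define N where "N = {z. \<not> P z}"
  have "N = UNIV - {z. P z}" by (auto simp: N_def)
  then have N [measurable]: "N \<in> sets borel" using P by auto
  have "(\<integral>\<^sup>+z. indicator N z \<partial>lborel) = (\<integral>\<^sup>+z. 0 \<partial>(lborel :: complex measure))"
    by (intro nn_integral_cong_AE, use ae in eventually_elim) (auto simp: N_def)
  then have "0 = (\<integral>\<^sup>+z. indicator N z \<partial>(lborel :: complex measure))" by simp
  also have "\<dots> = (\<integral>\<^sup>+t. indicator {0<..2 * pi} t * (\<integral>\<^sup>+r. indicator {0<..} r * (ennreal r * indicator N (rcis r t)) \<partial>lborel) \<partial>lborel)"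
    by (rule nn_integral_polar) measurable
  finally have "AE t in lborel. indicator {0<..2 * pi} t * (\<integral>\<^sup>+r. indicator {0<..} r * (ennreal r * indicator N (rcis r t)) \<partial>lborel) = 0"
  proof (subst nn_integral_0_iff_AE[symmetric])
    show "(\<lambda>t. indicator {0<..2 * pi} t * (\<integral>\<^sup>+r. indicator {0<..} r * (ennreal r * indicator N (rcis r t)) \<partial>lborel)) \<in> borel_measurable lborel"
      by measurable
  qed (rule sym)
  then show *: "AE t in lborel. AE r in lborel. 0 < r \<longrightarrow> t \<in> {0<..2 * pi} \<longrightarrow> P (rcis r t)"
  proof eventually_elim
    case (elim t)
    show ?case
    proof (cases "t \<in> {0<..2 * pi}")
      case True
      with elim have "(\<integral>\<^sup>+r. indicator {0<..} r * (ennreal r * indicator N (rcis r t)) \<partial>lborel) = 0" by simp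
      then have "AE r in lborel. indicator {0<..} r * (ennreal r * indicator N (rcis r t)) = 0"
        by (subst (asm) nn_integral_0_iff_AE) measurable
      then show ?thesis by eventually_elim (auto simp: N_def split: split_indicator_asm)
    qed auto
  qed
  have "{x \<in> space (lborel \<Otimes>\<^sub>M lborel). 0 < snd x \<longrightarrow> fst x \<in> {0<..2 * pi} \<longrightarrow> rcis (snd x) (fst x) \<notin> N} \<in> sets (lborel \<Otimes>\<^sub>M lborel)"
    by measurable
  then have "{x \<in> space (lborel \<Otimes>\<^sub>M lborel). 0 < snd x \<longrightarrow> fst x \<in> {0<..2 * pi} \<longrightarrow> P (rcis (snd x) (fst x))} \<in> sets (lborel \<Otimes>\<^sub>M lborel)"
    by (simp add: N_def)
  from lborel_pair.AE_commute[OF this, THEN iffD1, OF *]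
  show "AE r in lborel. AE t in lborel. 0 < r \<longrightarrow> t \<in> {0<..2 * pi} \<longrightarrow> P (rcis r t)" .
qed

section \<open>Measurable choice of the roots of a polynomial\<close>

text \<open>On a compact set a continuous function has a zero iff it takes arbitrarily small values on a
  countable dense subset, and the latter condition is a countable combination of measurable ones.\<close>

lemma sets_ex_zero_compact:
  fixes f :: "'a \<Rightarrow> 'b::euclidean_space \<Rightarrow> complex"
  assumes K: "compact K"
    and meas: "\<And>z. z \<in> K \<Longrightarrow> (\<lambda>x. f x z) \<in> borel_measurable M"
    and cont: "\<And>x. x \<in> space M \<Longrightarrow> continuous_on K (f x)"
  shows "{x\<in>space M. \<exists>z\<in>K. f x z = 0} \<in> sets M"
proof -
  obtain D where D: "countable D" "D \<subseteq> K" "K \<subseteq> closure D" using separable by blast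
  have "(\<exists>z\<in>K. f x z = 0) \<longleftrightarrow> (\<forall>k::nat. \<exists>z\<in>D. norm (f x z) < 1 / real (Suc k))" if x: "x \<in> space M" for x
  proof
    assume "\<exists>z\<in>K. f x z = 0"
    then obtain z where z: "z \<in> K" "f x z = 0" by blast
    show "\<forall>k::nat. \<exists>z\<in>D. norm (f x z) < 1 / real (Suc k)"
    proof
      fix k :: nat
      have "0 < 1 / real (Suc k)" by simp
      with cont[OF x] z obtain d where d: "d > 0" "\<And>w. w \<in> K \<Longrightarrow> dist w z < d \<Longrightarrow> dist (f x w) (f x z) < 1 / real (Suc k)"
        unfolding continuous_on_iff by metis
      obtain w where "w \<in> D" "dist w z < d" using D(3) z(1) d(1) closure_approachable by blast
      then show "\<exists>z\<in>D. norm (f x z) < 1 / real (Suc k)" using d(2)[of w] D(2) z(2) by auto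
    qed
  next
    assume *: "\<forall>k::nat. \<exists>z\<in>D. norm (f x z) < 1 / real (Suc k)"
    then have "K \<noteq> {}" using D(2) by blast
    with K cont[OF x] obtain z where z: "z \<in> K" "\<And>w. w \<in> K \<Longrightarrow> norm (f x z) \<le> norm (f x w)"
      using continuous_attains_inf[OF K, of "\<lambda>z. norm (f x z)"] by (metis continuous_on_norm)
    have "f x z = 0"
    proof (rule ccontr)
      assume "f x z \<noteq> 0"
      then have "0 < norm (f x z)" by simp
      then obtain k where k: "1 / real (Suc k) < norm (f x z)" by (rule nat_approx_posE)
      obtain w where "w \<in> D" "norm (f x w) < 1 / real (Suc k)" using * by blast
      with k z(2)[of w] D(2) show False by force
    qed
    with z show "\<exists>z\<in>K. f x z = 0" by blast
  qed
  then have "{x\<in>space M. \<exists>z\<in>K. f x z = 0} = {x\<in>space M. \<forall>k::nat. \<exists>z\<in>D. norm (f x z) < 1 / real (Suc k)}"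
    by blast
  also have "\<dots> \<in> sets M"
  proof (intro sets.sets_Collect_countable_All)
    fix k :: nat
    have "{x\<in>space M. norm (f x z) < 1 / real (Suc k)} \<in> sets M" if "z \<in> D" for z
    proof -
      have [measurable]: "(\<lambda>x. f x z) \<in> borel_measurable M" using meas that D(2) by blast
      show ?thesis by measurable
    qed
    then show "{x\<in>space M. \<exists>z\<in>D. norm (f x z) < 1 / real (Suc k)} \<in> sets M"
      using D(1) by (intro sets.sets_Collect_countable_Ex') auto
  qed
  finally show ?thesis .
qed

lemma sets_ex_zero_closed:
  fixes f :: "'a \<Rightarrow> 'b::euclidean_space \<Rightarrow> complex"
  assumes K: "closed K"
    and meas: "\<And>z. z \<in> K \<Longrightarrow> (\<lambda>x. f x z) \<in> borel_measurable M"
    and cont: "\<And>x. x \<in> space M \<Longrightarrow> continuous_on K (f x)"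
  shows "{x\<in>space M. \<exists>z\<in>K. f x z = 0} \<in> sets M"
proof -
  have "{x\<in>space M. \<exists>z\<in>K. f x z = 0} = {x\<in>space M. \<exists>R::nat. \<exists>z\<in>K \<inter> cball 0 (real R). f x z = 0}"
    (is "?A = ?B")
  proof (intro equalityI subsetI)
    fix x assume "x \<in> ?A"
    then obtain z where z: "x \<in> space M" "z \<in> K" "f x z = 0" by blast
    obtain R :: nat where "norm z \<le> real R" using real_arch_simple by blast
    with z show "x \<in> ?B" by (auto intro!: exI[of _ R] bexI[of _ z])
  qed auto
  also have "\<dots> \<in> sets M"
    using K by (intro sets.sets_Collect_countable_Ex sets_ex_zero_compact closed_Int_compact)
      (auto intro: meas continuous_on_subset[OF cont])
  finally show ?thesis .
qed

text \<open>Measurability is required coefficientwise, since polynomials do not come with a Borel algebra.\<close>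

definition measurable_poly :: "'a measure \<Rightarrow> ('a \<Rightarrow> complex poly) \<Rightarrow> bool" where
  "measurable_poly M P \<longleftrightarrow> (\<forall>i. (\<lambda>x. coeff (P x) i) \<in> borel_measurable M)"

lemma measurable_poly_eval:
  assumes P: "measurable_poly M P" and d: "\<And>x. x \<in> space M \<Longrightarrow> degree (P x) \<le> d"
    and [measurable]: "z \<in> borel_measurable M"
  shows "(\<lambda>x. poly (P x) (z x)) \<in> borel_measurable M"
proof -
  have [measurable]: "(\<lambda>x. coeff (P x) i) \<in> borel_measurable M" for i
    using P by (simp add: measurable_poly_def)
  have "poly (P x) (z x) = (\<Sum>i\<le>d. coeff (P x) i * z x ^ i)" if "x \<in> space M" for x
    unfolding poly_altdef using d[OF that]
    by (intro sum.mono_neutral_left) (auto simp: coeff_eq_0)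
  then show ?thesis by (subst measurable_cong) auto
qed

text \<open>Choose the root with the smallest real part and, among those, the smallest imaginary part. Both
  coordinates are measurable, since "some root lies in a given closed set" is a measurable event.\<close>

lemma measurable_poly_root:
  assumes P: "measurable_poly M P" and d: "\<And>x. x \<in> space M \<Longrightarrow> degree (P x) = Suc d"
  obtains \<zeta> where "\<zeta> \<in> borel_measurable M" "\<And>x. x \<in> space M \<Longrightarrow> poly (P x) (\<zeta> x) = 0"
proof -
  define Z where "Z x = {z. poly (P x) z = 0}" for x
  have fin: "finite (Z x)" if "x \<in> space M" for x
    using d[OF that] unfolding Z_def by (intro poly_roots_finite) auto
  have ne: "Z x \<noteq> {}" if "x \<in> space M" for x
    using d[OF that] fundamental_theorem_of_algebra[of "P x"] unfolding Z_def
    by (auto simp: constant_degree)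
  \<comment> \<open>\<open>u\<close> is the least real part of a root, \<open>v\<close> the least imaginary part of a root on the line \<open>Re z = u\<close>.\<close>
  define u where "u x = Min (Re ` Z x)" for x
  define Y where "Y x = {y. poly (P x) (Complex (u x) y) = 0}" for x
  define v where "v x = Min (Y x)" for x
  have u_le: "u x \<le> c \<longleftrightarrow> (\<exists>z\<in>{z. Re z \<le> c}. poly (P x) z = 0)" if "x \<in> space M" for x c
    unfolding u_def using fin[OF that] ne[OF that] by (subst Min_le_iff) (auto simp: Z_def)
  have um [measurable]: "u \<in> borel_measurable M"
    unfolding borel_measurable_iff_le
  proof
    fix c
    have "{x \<in> space M. u x \<le> c} = {x \<in> space M. \<exists>z\<in>{z. Re z \<le> c}. poly (P x) z = 0}"
      using u_le by blast
    also have "\<dots> \<in> sets M"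
      by (intro sets_ex_zero_closed closed_halfspace_Re_le measurable_poly_eval[OF P] continuous_intros)
         (use d in auto)
    finally show "{x \<in> space M. u x \<le> c} \<in> sets M" .
  qed
  have Yne: "Y x \<noteq> {}" if "x \<in> space M" for x
  proof -
    have "u x \<in> Re ` Z x" unfolding u_def using fin[OF that] ne[OF that] by (intro Min_in) auto
    then obtain z where "z \<in> Z x" "u x = Re z" by blast
    then have "Im z \<in> Y x" by (simp add: Y_def Z_def)
    then show ?thesis by blast
  qed
  have Yfin: "finite (Y x)" if "x \<in> space M" for x
  proof (rule finite_subset)
    show "Y x \<subseteq> Im ` Z x" by (force simp: Y_def Z_def)
  qed (use fin that in auto)
  have v_le: "v x \<le> c \<longleftrightarrow> (\<exists>y\<in>{..c}. poly (P x) (Complex (u x) y) = 0)" if "x \<in> space M" for x c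
    unfolding v_def using Yfin[OF that] Yne[OF that] by (subst Min_le_iff) (auto simp: Y_def)
  have vm [measurable]: "v \<in> borel_measurable M"
    unfolding borel_measurable_iff_le
  proof
    fix c
    have "{x \<in> space M. v x \<le> c} = {x \<in> space M. \<exists>y\<in>{..c}. poly (P x) (Complex (u x) y) = 0}"
      using v_le by blast
    also have "\<dots> \<in> sets M"
    proof (intro sets_ex_zero_closed closed_atMost measurable_poly_eval[OF P])
      show "degree (P x) \<le> Suc d" if "x \<in> space M" for x using d[OF that] by simp
      show "(\<lambda>x. Complex (u x) y) \<in> borel_measurable M" for y unfolding Complex_eq by measurable
      show "continuous_on {..c} (\<lambda>y. poly (P x) (Complex (u x) y))" for x
        unfolding Complex_eq by (intro continuous_intros)
    qed
    finally show "{x \<in> space M. v x \<le> c} \<in> sets M" .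
  qed
  have "(\<lambda>x. Complex (u x) (v x)) \<in> borel_measurable M" unfolding Complex_eq by measurable
  moreover have "poly (P x) (Complex (u x) (v x)) = 0" if "x \<in> space M" for x
    using Min_in[OF Yfin Yne, OF that that] unfolding v_def Y_def by simp
  ultimately show ?thesis by (rule that)
qed

text \<open>The coefficients of the quotient are computed from the top down by Horner's recursion.\<close>

lemma measurable_poly_synthetic_div:
  assumes P: "measurable_poly M P" and d: "\<And>x. x \<in> space M \<Longrightarrow> degree (P x) \<le> d"
    and z[measurable]: "z \<in> borel_measurable M"
  shows "measurable_poly M (\<lambda>x. synthetic_div (P x) (z x))"
  unfolding measurable_poly_def
proof
  fix i
  have [measurable]: "(\<lambda>x. coeff (P x) i) \<in> borel_measurable M" for i
    using P by (simp add: measurable_poly_def)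
  have step: "coeff (synthetic_div (P x) (z x)) i = coeff (P x) (Suc i) + z x * coeff (synthetic_div (P x) (z x)) (Suc i)" for x i
    using arg_cong[OF synthetic_div_correct[of "P x" "z x"], of "\<lambda>q. coeff q (Suc i)"] by simp
  show "(\<lambda>x. coeff (synthetic_div (P x) (z x)) i) \<in> borel_measurable M"
  proof (induction "Suc d - i" arbitrary: i)
    case 0
    have "coeff (synthetic_div (P x) (z x)) i = 0" if "x \<in> space M" for x
      using 0 d[OF that] by (intro coeff_eq_0) (simp add: degree_synthetic_div)
    then show ?case by (subst measurable_cong[where g = "\<lambda>_. 0"]) auto
  next
    case (Suc k)
    have [measurable]: "(\<lambda>x. coeff (synthetic_div (P x) (z x)) (Suc i)) \<in> borel_measurable M"
      using Suc by (intro Suc) simp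
    show ?case by (subst step) measurable
  qed
qed

text \<open>Split off one measurable root after the other.\<close>

theorem measurable_poly_roots:
  assumes "measurable_poly M P" and "\<And>x. x \<in> space M \<Longrightarrow> degree (P x) = d"
  shows "\<exists>\<zeta>. (\<forall>j<d. \<zeta> j \<in> borel_measurable M) \<and>
    (\<forall>x\<in>space M. P x \<noteq> 0 \<longrightarrow> proots (P x) = image_mset (\<lambda>j. \<zeta> j x) (mset_set {..<d}))"
  using assms
proof (induction d arbitrary: P)
  case 0
  have "proots (P x) = {#}" if "x \<in> space M" for x
    using 0(2)[OF that] degree_0_id[of "P x"] proots_const by (metis empty_neutral(1))
  then show ?case by simp
next
  case (Suc d)
  obtain z where z: "z \<in> borel_measurable M" "\<And>x. x \<in> space M \<Longrightarrow> poly (P x) (z x) = 0"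
    using measurable_poly_root[OF Suc.prems] by blast
  define Q where "Q x = synthetic_div (P x) (z x)" for x
  have PQ: "P x = [:- z x, 1:] * Q x" if "x \<in> space M" for x
    using synthetic_div_correct'[of "z x" "P x"] z(2)[OF that] by (simp add: Q_def)
  have "measurable_poly M Q" unfolding Q_def
    using Suc.prems z(1) by (intro measurable_poly_synthetic_div[of _ _ "Suc d"]) auto
  moreover have "degree (Q x) = d" if "x \<in> space M" for x
    using Suc.prems(2)[OF that] by (simp add: Q_def degree_synthetic_div)
  ultimately obtain \<zeta> where \<zeta>: "\<forall>j<d. \<zeta> j \<in> borel_measurable M"
    "\<forall>x\<in>space M. Q x \<noteq> 0 \<longrightarrow> proots (Q x) = image_mset (\<lambda>j. \<zeta> j x) (mset_set {..<d})"
    using Suc.IH by blast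
  define \<zeta>' where "\<zeta>' = \<zeta>(d := z)"
  have "\<forall>j<Suc d. \<zeta>' j \<in> borel_measurable M"
    using \<zeta>(1) z(1) by (auto simp: \<zeta>'_def less_Suc_eq)
  moreover have "proots (P x) = image_mset (\<lambda>j. \<zeta>' j x) (mset_set {..<Suc d})" if x: "x \<in> space M" "P x \<noteq> 0" for x
  proof -
    have Q0: "Q x \<noteq> 0" using PQ[OF x(1)] x(2) by auto
    have "proots (P x) = {#z x#} + proots (Q x)"
      using Q0 by (subst PQ[OF x(1)], subst proots_mult) auto
    also have "proots (Q x) = image_mset (\<lambda>j. \<zeta>' j x) (mset_set {..<d})"
      using \<zeta>(2) x(1) Q0 by (auto simp: \<zeta>'_def intro!: image_mset_cong)
    finally show ?thesis by (simp add: lessThan_Suc \<zeta>'_def)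
  qed
  ultimately show ?case by blast
qed

lemma measurable_poly_const [intro]: "f \<in> borel_measurable M \<Longrightarrow> measurable_poly M (\<lambda>x. [:f x:])"
  by (auto simp: measurable_poly_def coeff_pCons split: nat.split)

lemma measurable_poly_fixed [intro]: "measurable_poly M (\<lambda>x. p)"
  by (simp add: measurable_poly_def)

lemma measurable_poly_add [intro]:
  "measurable_poly M P \<Longrightarrow> measurable_poly M Q \<Longrightarrow> measurable_poly M (\<lambda>x. P x + Q x)"
  unfolding measurable_poly_def coeff_add coeff_diff
  by (intro allI borel_measurable_add borel_measurable_diff) auto

lemma measurable_poly_diff [intro]:
  "measurable_poly M P \<Longrightarrow> measurable_poly M Q \<Longrightarrow> measurable_poly M (\<lambda>x. P x - Q x)"
  unfolding measurable_poly_def coeff_add coeff_diff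
  by (intro allI borel_measurable_add borel_measurable_diff) auto

lemma measurable_poly_mult [intro]:
  "measurable_poly M P \<Longrightarrow> measurable_poly M Q \<Longrightarrow> measurable_poly M (\<lambda>x. P x * Q x)"
  unfolding measurable_poly_def coeff_mult
  by (intro allI borel_measurable_sum borel_measurable_times) auto

lemma measurable_poly_sum [intro]:
  "(\<And>i. i \<in> A \<Longrightarrow> measurable_poly M (P i)) \<Longrightarrow> measurable_poly M (\<lambda>x. \<Sum>i\<in>A. P i x)"
  by (induction A rule: infinite_finite_induct) auto

lemma measurable_poly_prod [intro]:
  "(\<And>i. i \<in> A \<Longrightarrow> measurable_poly M (P i)) \<Longrightarrow> measurable_poly M (\<lambda>x. \<Prod>i\<in>A. P i x)"
  by (induction A rule: infinite_finite_induct) auto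

lemma measurable_poly_det:
  assumes "\<And>x. A x \<in> carrier_mat p p"
    and "\<And>i j. i < p \<Longrightarrow> j < p \<Longrightarrow> measurable_poly M (\<lambda>x. A x $$ (i, j))"
  shows "measurable_poly M (\<lambda>x. det (A x))"
proof -
  have "det (A x) = (\<Sum>\<pi>\<in>{\<pi>. \<pi> permutes {0..<p}}. signof \<pi> * (\<Prod>i = 0..<p. A x $$ (i, \<pi> i)))" for x
    using assms(1) by (rule det_def')
  then show ?thesis
    by (auto intro!: assms(2) measurable_poly_sum measurable_poly_mult measurable_poly_prod simp: permutes_in_image)
qed

section \<open>Algebra of the Hankel pencil\<close>

text \<open>In the Leibniz expansion every term is a product of \<open>p\<close> linear factors, whose coefficient of degree
  \<open>p\<close> is the product of the slopes.\<close>

lemma det_linear_pencil: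
  fixes P :: "complex poly mat"
  assumes P: "P \<in> carrier_mat p p" and A: "A \<in> carrier_mat p p" and B: "B \<in> carrier_mat p p"
    and entry: "\<And>i j. i < p \<Longrightarrow> j < p \<Longrightarrow> P $$ (i, j) = [:A $$ (i, j), B $$ (i, j):]"
  shows "degree (det P) \<le> p" "coeff (det P) p = det B"
    "poly (det P) z = det (A + z \<cdot>\<^sub>m B)"
proof -
  have perm: "\<pi> i < p" if "\<pi> permutes {0..<p}" "i < p" for \<pi> i
    using permutes_in_image[OF that(1), of i] that(2) by simp
  have "degree (P $$ (i, j)) \<le> 1" if "i < p" "j < p" for i j
    using entry[OF that] by simp
  from degree_det_le[OF this P] show "degree (det P) \<le> p" by simp
  have top: "coeff (\<Prod>i\<in>I. [:a i, b i:]) (card I) = (\<Prod>i\<in>I. b i)" if "finite I" for I and a b :: "nat \<Rightarrow> complex"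
    using that
  proof (induction I rule: finite_induct)
    case (insert k I)
    have "degree (\<Prod>i\<in>I. [:a i, b i:]) \<le> sum (\<lambda>i. degree [:a i, b i:]) I"
      using degree_prod_sum_le[OF insert.hyps(1), of "\<lambda>i. [:a i, b i:]"] by (simp add: comp_def)
    also have "\<dots> \<le> (\<Sum>i\<in>I. 1)" by (intro sum_mono) simp
    finally have "degree (\<Prod>i\<in>I. [:a i, b i:]) \<le> card I" by simp
    then have "coeff (\<Prod>i\<in>I. [:a i, b i:]) (Suc (card I)) = 0" by (intro coeff_eq_0) simp
    with insert show ?case by simp
  qed simp
  have "coeff (det P) p = (\<Sum>\<pi>\<in>{\<pi>. \<pi> permutes {0..<p}}. coeff (signof \<pi> * (\<Prod>i = 0..<p. P $$ (i, \<pi> i))) p)"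
    unfolding det_def'[OF P] by (rule coeff_sum)
  also have "\<dots> = (\<Sum>\<pi>\<in>{\<pi>. \<pi> permutes {0..<p}}. signof \<pi> * (\<Prod>i = 0..<p. B $$ (i, \<pi> i)))"
  proof (intro sum.cong refl)
    fix \<pi> assume "\<pi> \<in> {\<pi>. \<pi> permutes {0..<p}}"
    then have "(\<Prod>i = 0..<p. P $$ (i, \<pi> i)) = (\<Prod>i = 0..<p. [:A $$ (i, \<pi> i), B $$ (i, \<pi> i):])"
      by (intro prod.cong refl entry) (auto intro: perm)
    with top[of "{0..<p}" "\<lambda>i. A $$ (i, \<pi> i)" "\<lambda>i. B $$ (i, \<pi> i)"]
    show "coeff (signof \<pi> * (\<Prod>i = 0..<p. P $$ (i, \<pi> i))) p = signof \<pi> * (\<Prod>i = 0..<p. B $$ (i, \<pi> i))"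
      by (simp add: sign_def)
  qed
  finally show "coeff (det P) p = det B" by (simp add: det_def'[OF B])
  have "poly (det P) z = (\<Sum>\<pi>\<in>{\<pi>. \<pi> permutes {0..<p}}. poly (signof \<pi> * (\<Prod>i = 0..<p. P $$ (i, \<pi> i))) z)"
    unfolding det_def'[OF P] by (rule poly_sum)
  also have "\<dots> = (\<Sum>\<pi>\<in>{\<pi>. \<pi> permutes {0..<p}}. signof \<pi> * (\<Prod>i = 0..<p. (A + z \<cdot>\<^sub>m B) $$ (i, \<pi> i)))"
  proof (intro sum.cong refl)
    fix \<pi> assume \<pi>: "\<pi> \<in> {\<pi>. \<pi> permutes {0..<p}}"
    then have "(\<Prod>i = 0..<p. poly (P $$ (i, \<pi> i)) z) = (\<Prod>i = 0..<p. (A + z \<cdot>\<^sub>m B) $$ (i, \<pi> i))"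
      using A B by (intro prod.cong refl) (auto simp: entry perm)
    then show "poly (signof \<pi> * (\<Prod>i = 0..<p. P $$ (i, \<pi> i))) z = signof \<pi> * (\<Prod>i = 0..<p. (A + z \<cdot>\<^sub>m B) $$ (i, \<pi> i))"
      by (simp add: sign_def poly_prod)
  qed
  also have "\<dots> = det (A + z \<cdot>\<^sub>m B)"
    by (rule det_def'[symmetric]) (use A B in auto)
  finally show "poly (det P) z = det (A + z \<cdot>\<^sub>m B)" .
qed

lemma hankel_carrier [simp]: "hankel p s \<in> carrier_mat p p"
  by (simp add: hankel_def)

lemma index_hankel [simp]: "i < p \<Longrightarrow> j < p \<Longrightarrow> hankel p s $$ (i, j) = s (i + j)"
  by (simp add: hankel_def)

lemma pade_poly_pencil:
  fixes n s
  defines "p \<equiv> n div 2"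
  shows degree_pade_poly_le: "degree (pade_poly n s) \<le> p"
    and coeff_pade_poly: "coeff (pade_poly n s) p = det (- hankel p s)"
    and poly_pade_poly: "poly (pade_poly n s) z = det (mat p p (\<lambda>(i, j). s (i + j + 1) - z * s (i + j)))"
proof -
  let ?P = "map_mat (\<lambda>c. [:c:]) (hankel p (\<lambda>k. s (k + 1))) - [:0, 1:] \<cdot>\<^sub>m map_mat (\<lambda>c. [:c:]) (hankel p s)"
  have P: "?P \<in> carrier_mat p p" by (auto simp: hankel_def)
  have entry: "?P $$ (i, j) = [:hankel p (\<lambda>k. s (k + 1)) $$ (i, j), (- hankel p s) $$ (i, j):]"
    if "i < p" "j < p" for i j
    using that by (simp add: hankel_def)
  note * = det_linear_pencil[OF P hankel_carrier _ entry]
  show "degree (pade_poly n s) \<le> p" unfolding pade_poly_def p_def[symmetric] by (rule *(1)) auto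
  show "coeff (pade_poly n s) p = det (- hankel p s)" unfolding pade_poly_def p_def[symmetric] by (rule *(2)) auto
  have "poly (pade_poly n s) z = det (hankel p (\<lambda>k. s (k + 1)) + z \<cdot>\<^sub>m (- hankel p s))"
    unfolding pade_poly_def p_def[symmetric] by (rule *(3)) auto
  also have "hankel p (\<lambda>k. s (k + 1)) + z \<cdot>\<^sub>m (- hankel p s) = mat p p (\<lambda>(i, j). s (i + j + 1) - z * s (i + j))"
    by (rule eq_matI) (auto simp: hankel_def)
  finally show "poly (pade_poly n s) z = det (mat p p (\<lambda>(i, j). s (i + j + 1) - z * s (i + j)))" .
qed

text \<open>For even \<open>n\<close> the largest index in the pencil is \<open>2 (n / 2) - 1 = n - 1\<close>.\<close>

lemma pade_poly_cong:
  assumes "even n" "\<And>k. k < n \<Longrightarrow> s k = t k"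
  shows "pade_poly n s = pade_poly n t"
proof -
  have "mat (n div 2) (n div 2) (\<lambda>(i, j). s (i + j + 1) - z * s (i + j))
      = mat (n div 2) (n div 2) (\<lambda>(i, j). t (i + j + 1) - z * t (i + j))" for z
    using assms by (intro eq_matI) (auto elim!: evenE)
  then have "poly (pade_poly n s) = poly (pade_poly n t)"
    by (intro ext) (simp add: poly_pade_poly)
  then show ?thesis by (simp add: poly_eq_poly_eq_iff)
qed

lemma pade_poly_scale:
  "pade_poly n (\<lambda>k. c * s k) = Polynomial.smult (c ^ (n div 2)) (pade_poly n s)"
proof -
  have "mat (n div 2) (n div 2) (\<lambda>(i, j). c * s (i + j + 1) - z * (c * s (i + j)))
      = c \<cdot>\<^sub>m mat (n div 2) (n div 2) (\<lambda>(i, j). s (i + j + 1) - z * s (i + j))" for z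
    by (intro eq_matI) (auto simp: algebra_simps)
  then have "poly (pade_poly n (\<lambda>k. c * s k)) = poly (Polynomial.smult (c ^ (n div 2)) (pade_poly n s))"
    by (intro ext) (simp add: poly_pade_poly)
  then show ?thesis by (simp add: poly_eq_poly_eq_iff)
qed

lemma pade_poles_scale: "c \<noteq> 0 \<Longrightarrow> pade_poles n (\<lambda>k. c * s k) = pade_poles n s"
  by (simp add: pade_poles_def pade_poly_scale)

text \<open>The dilation multiplies entry \<open>(i, j)\<close> of the pencil by \<open>l ^ i * l * l ^ j\<close>, that is, it multiplies the
  matrix by a scalar and from both sides by the diagonal matrix of the powers of \<open>l\<close>.\<close>

lemma poly_pade_poly_dilate:
  "poly (pade_poly n (\<lambda>k. l ^ k * s k)) (l * w)
    = (\<Prod>i<n div 2. l ^ (2 * i + 1)) * poly (pade_poly n s) w"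
proof -
  define p where "p = n div 2"
  let ?A = "mat p p (\<lambda>(i, j). l ^ (i + j + 1) * s (i + j + 1) - l * w * (l ^ (i + j) * s (i + j)))"
  let ?B = "mat p p (\<lambda>(i, j). s (i + j + 1) - w * s (i + j))"
  have "det ?A = (\<Sum>\<pi>\<in>{\<pi>. \<pi> permutes {0..<p}}. signof \<pi> * (\<Prod>i = 0..<p. ?A $$ (i, \<pi> i)))"
    by (rule det_def') simp
  also have "\<dots> = (\<Sum>\<pi>\<in>{\<pi>. \<pi> permutes {0..<p}}. (\<Prod>i<p. l ^ (2 * i + 1)) * (signof \<pi> * (\<Prod>i = 0..<p. ?B $$ (i, \<pi> i))))"
  proof (intro sum.cong refl)
    fix \<pi> assume "\<pi> \<in> {\<pi>. \<pi> permutes {0..<p}}"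
    then have \<pi>: "\<pi> permutes {0..<p}" by simp
    have lt: "\<pi> i < p" if "i < p" for i
      using permutes_in_image[OF \<pi>, of i] that by simp
    have "(\<Prod>i = 0..<p. ?A $$ (i, \<pi> i)) = (\<Prod>i = 0..<p. l ^ i * l * l ^ \<pi> i * ?B $$ (i, \<pi> i))"
      by (intro prod.cong refl) (auto simp: lt power_add algebra_simps)
    also have "\<dots> = (\<Prod>i = 0..<p. l ^ i * l) * (\<Prod>i = 0..<p. l ^ \<pi> i) * (\<Prod>i = 0..<p. ?B $$ (i, \<pi> i))"
      by (simp add: prod.distrib)
    also have "(\<Prod>i = 0..<p. l ^ \<pi> i) = (\<Prod>i = 0..<p. l ^ i)"
      using prod.permute[OF \<pi>, of "\<lambda>i. l ^ i"] by (simp add: comp_def)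
    also have "(\<Prod>i = 0..<p. l ^ i * l) * (\<Prod>i = 0..<p. l ^ i) = (\<Prod>i<p. l ^ (2 * i + 1))"
      unfolding prod.distrib[symmetric] atLeast0LessThan
      by (intro prod.cong refl) (simp add: mult_2 power_add)
    finally show "signof \<pi> * (\<Prod>i = 0..<p. ?A $$ (i, \<pi> i))
        = (\<Prod>i<p. l ^ (2 * i + 1)) * (signof \<pi> * (\<Prod>i = 0..<p. ?B $$ (i, \<pi> i)))"
      by simp
  qed
  also have "\<dots> = (\<Prod>i<p. l ^ (2 * i + 1)) * (\<Sum>\<pi>\<in>{\<pi>. \<pi> permutes {0..<p}}. (signof \<pi> * (\<Prod>i = 0..<p. ?B $$ (i, \<pi> i))))"
    by (rule sum_distrib_left[symmetric])
  also have "(\<Sum>\<pi>\<in>{\<pi>. \<pi> permutes {0..<p}}. (signof \<pi> * (\<Prod>i = 0..<p. ?B $$ (i, \<pi> i)))) = det ?B"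
    by (rule det_def'[symmetric]) simp
  finally show ?thesis by (simp add: poly_pade_poly p_def)
qed

lemma proots_dilate:
  fixes P Q :: "complex poly"
  assumes l: "l \<noteq> 0" and K: "K \<noteq> 0" and PQ: "\<And>w. poly Q (l * w) = K * poly P w"
  shows "proots Q = image_mset ((*) l) (proots P)"
proof (cases "P = 0")
  case True
  then have "poly Q z = 0" for z using PQ[of "z / l"] l by simp
  then have "Q = 0" using poly_all_0_iff_0 by blast
  then show ?thesis using True by simp
next
  case False
  define c where "c = K * lead_coeff P / l ^ size (proots P)"
  have prod: "(\<Prod>x\<in>#A. z / l - x) = (\<Prod>x\<in>#A. z - l * x) / l ^ size A" for z and A :: "complex multiset"
    using l by (induction A) (auto simp: field_simps)
  have "poly Q z = poly (Polynomial.smult c (\<Prod>x\<in>#proots P. [:- (l * x), 1:])) z" for z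
  proof -
    have "poly Q z = K * poly P (z / l)" using PQ[of "z / l"] l by simp
    also have "poly P (z / l) = lead_coeff P * (\<Prod>x\<in>#proots P. z / l - x)"
      by (subst complex_poly_decompose_multiset[symmetric]) (simp add: poly_prod_mset image_mset.compositionality comp_def)
    also have "K * (lead_coeff P * (\<Prod>x\<in>#proots P. z / l - x)) = c * (\<Prod>x\<in>#proots P. z - l * x)"
      by (simp add: prod c_def)
    finally show ?thesis by (simp add: poly_prod_mset image_mset.compositionality comp_def)
  qed
  then have "Q = Polynomial.smult c (\<Prod>x\<in>#proots P. [:- (l * x), 1:])"
    by (metis ext poly_eq_poly_eq_iff)
  moreover have "c \<noteq> 0" using False K l by (simp add: c_def)
  ultimately have "proots Q = proots (\<Prod>x\<in>#proots P. [:- (l * x), 1:])" by simp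
  also have "\<dots> = image_mset ((*) l) (proots P)"
  proof -
    have "0 \<notin># image_mset (\<lambda>x. [:- (l * x), 1:]) (proots P)" by auto
    from proots_prod_mset[OF this] show ?thesis
      by (simp add: image_mset.compositionality comp_def)
  qed
  finally show ?thesis .
qed

lemma pade_poles_dilate:
  assumes "l \<noteq> 0"
  shows "pade_poles n (\<lambda>k. l ^ k * s k) = image_mset ((*) l) (pade_poles n s)"
  unfolding pade_poles_def
  by (rule proots_dilate[OF assms _ poly_pade_poly_dilate]) (use assms in auto)

section \<open>Generic coefficient vectors\<close>

text \<open>The inverse of \<open>real_vector_of\<close>, for indices \<open>k < n\<close>.\<close>

definition complex_coords :: "nat \<Rightarrow> (nat \<Rightarrow> real) \<Rightarrow> nat \<Rightarrow> complex" where
  "complex_coords n x k = Complex (x k) (x (n + k))"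

definition poles_at :: "nat \<Rightarrow> (nat \<Rightarrow> real) \<Rightarrow> complex multiset" where
  "poles_at n x = pade_poles n (complex_coords n x)"

text \<open>Equivalently, the determinant of the pencil has the full degree \<open>n div 2\<close>.\<close>

definition regular :: "nat \<Rightarrow> (nat \<Rightarrow> real) \<Rightarrow> bool" where
  "regular n x \<longleftrightarrow> size (poles_at n x) = n div 2"

lemma size_poles_at: "size (poles_at n x) = degree (pade_poly n (complex_coords n x))"
  by (simp add: poles_at_def pade_poles_def size_proots_complex)

lemma regular_iff:
  assumes "n \<ge> 2"
  shows "regular n x \<longleftrightarrow> coeff (pade_poly n (complex_coords n x)) (n div 2) \<noteq> 0"
proof -
  have "n div 2 > 0" using assms by simp
  then show ?thesis
    using degree_pade_poly_le[of n "complex_coords n x"] unfolding regular_def size_poles_at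
    by (metis coeff_0_degree_minus_1 coeff_eq_0 degree_0 le_antisym le_degree leading_coeff_0_iff le_less less_not_refl)
qed

lemma measurable_complex_coords:
  assumes "k < n"
  shows "(\<lambda>x. complex_coords n x k) \<in> borel_measurable (coord_space (2 * n))"
proof -
  have [measurable]: "(\<lambda>x. x k) \<in> borel_measurable (coord_space (2 * n))"
    "(\<lambda>x. x (n + k)) \<in> borel_measurable (coord_space (2 * n))"
    using assms by (auto intro!: measurable_component_singleton)
  show ?thesis unfolding complex_coords_def Complex_eq by measurable
qed

lemma measurable_poly_pade_poly:
  assumes "even n"
  shows "measurable_poly (coord_space (2 * n)) (\<lambda>x. pade_poly n (complex_coords n x))"
proof -
  have "measurable_poly (coord_space (2 * n)) (\<lambda>x.
     (map_mat (\<lambda>c. [:c:]) (hankel (n div 2) (\<lambda>k. complex_coords n x (k + 1)))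
          - [:0, 1:] \<cdot>\<^sub>m map_mat (\<lambda>c. [:c:]) (hankel (n div 2) (complex_coords n x))) $$ (i, j))"
    if "i < n div 2" "j < n div 2" for i j
  proof -
    have k: "i + j + 1 < n" "i + j < n" using that assms by (auto elim!: evenE)
    have "measurable_poly (coord_space (2 * n)) (\<lambda>x. [:complex_coords n x (i + j + 1):] - [:0, 1:] * [:complex_coords n x (i + j):])"
      by (intro measurable_poly_diff measurable_poly_mult measurable_poly_const measurable_poly_fixed measurable_complex_coords k)
    then show ?thesis using that by (simp add: hankel_def)
  qed
  then show ?thesis unfolding pade_poly_def
    by (intro measurable_poly_det[where p = "n div 2"]) (auto simp: hankel_def)
qed

lemma sets_regular:
  assumes "even n" "n \<ge> 2"
  shows "{x\<in>space (coord_space (2 * n)). regular n x} \<in> sets (coord_space (2 * n))"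
proof -
  have [measurable]: "(\<lambda>x. coeff (pade_poly n (complex_coords n x)) (n div 2)) \<in> borel_measurable (coord_space (2 * n))"
    using measurable_poly_pade_poly[OF assms(1)] by (simp add: measurable_poly_def)
  show ?thesis unfolding regular_iff[OF assms(2)] by measurable
qed

lemma measurable_poles:
  assumes n: "even n" "n \<ge> 2"
  obtains \<zeta> where "\<And>j. j < n div 2 \<Longrightarrow> \<zeta> j \<in> borel_measurable (coord_space (2 * n))"
    "\<And>x. x \<in> space (coord_space (2 * n)) \<Longrightarrow> regular n x \<Longrightarrow>
       poles_at n x = image_mset (\<lambda>j. \<zeta> j x) (mset_set {..<n div 2})"
proof -
  define p where "p = n div 2"
  \<comment> \<open>The monomial at degenerate points makes the degree constant.\<close>
  define Q where "Q x = (if regular n x then pade_poly n (complex_coords n x) else monom 1 p)" for x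
  have [measurable]: "Measurable.pred (coord_space (2 * n)) (regular n)"
    using sets_regular[OF n] by (simp add: pred_def)
  have "measurable_poly (coord_space (2 * n)) Q"
    unfolding measurable_poly_def
  proof
    fix i
    have [measurable]: "(\<lambda>x. coeff (pade_poly n (complex_coords n x)) i) \<in> borel_measurable (coord_space (2 * n))"
      using measurable_poly_pade_poly[OF n(1)] by (simp add: measurable_poly_def)
    have "(\<lambda>x. coeff (Q x) i) = (\<lambda>x. if regular n x then coeff (pade_poly n (complex_coords n x)) i else coeff (monom 1 p) i)"
      by (auto simp: Q_def)
    then show "(\<lambda>x. coeff (Q x) i) \<in> borel_measurable (coord_space (2 * n))" by simp
  qed
  moreover have "degree (Q x) = p" for x
    using size_poles_at[of n x] by (auto simp: Q_def regular_def p_def degree_monom_eq)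
  ultimately obtain \<zeta> where \<zeta>: "\<forall>j<p. \<zeta> j \<in> borel_measurable (coord_space (2 * n))"
    "\<forall>x\<in>space (coord_space (2 * n)). Q x \<noteq> 0 \<longrightarrow> proots (Q x) = image_mset (\<lambda>j. \<zeta> j x) (mset_set {..<p})"
    using measurable_poly_roots[of "coord_space (2 * n)" Q p] by blast
  show ?thesis
  proof (rule that)
    show "\<zeta> j \<in> borel_measurable (coord_space (2 * n))" if "j < n div 2" for j
      using \<zeta>(1) that by (simp add: p_def)
    fix x assume x: "x \<in> space (coord_space (2 * n))" "regular n x"
    then have "degree (Q x) = p" "p > 0" using n size_poles_at[of n x] by (auto simp: Q_def regular_def p_def)
    then have "Q x \<noteq> 0" by auto
    with \<zeta>(2) x show "poles_at n x = image_mset (\<lambda>j. \<zeta> j x) (mset_set {..<n div 2})"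
      by (auto simp: Q_def poles_at_def pade_poles_def p_def)
  qed
qed

definition lebesgue_coords :: "nat \<Rightarrow> (nat \<Rightarrow> real) measure" where
  "lebesgue_coords m = (\<Pi>\<^sub>M i\<in>{..<m}. lborel)"

lemma sets_lebesgue_coords [simp, measurable_cong]: "sets (lebesgue_coords m) = sets (coord_space m)"
  unfolding lebesgue_coords_def by (intro sets_PiM_cong) auto

lemma space_lebesgue_coords [simp]: "space (lebesgue_coords m) = space (coord_space m)"
  by (rule sets_eq_imp_space_eq) simp

interpretation lborel_product: product_sigma_finite "\<lambda>_::nat. lborel :: real measure"
  by standard

lemma sigma_finite_lebesgue_coords: "sigma_finite_measure (lebesgue_coords m)"
  unfolding lebesgue_coords_def by (rule lborel_product.sigma_finite) simp

text \<open>Fubini in the single coordinate \<open>r\<close>. The hypothesis is over all functions \<open>x\<close>, not only the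
  extensional ones, since it is going to be applied to polynomial conditions on finitely many entries.\<close>

lemma AE_lebesgue_coords_coordinate:
  assumes P: "{x\<in>space (coord_space m). P x} \<in> sets (coord_space m)" and r: "r < m"
    and ae: "\<And>x. AE t in lborel. P (x(r := t))"
  shows "AE x in lebesgue_coords m. P x"
proof -
  let ?N = "{x\<in>space (coord_space m). \<not> P x}"
  have N: "?N \<in> sets (coord_space m)"
    using sets.sets_Collect_neg[OF P] .
  have ins: "insert r ({..<m} - {r}) = {..<m}" using r by auto
  have meas: "(indicator ?N :: _ \<Rightarrow> ennreal) \<in> borel_measurable (\<Pi>\<^sub>M i\<in>insert r ({..<m} - {r}). lborel)"
    unfolding ins lebesgue_coords_def[symmetric] using N by simp
  have "emeasure (lebesgue_coords m) ?N = (\<integral>\<^sup>+x. indicator ?N x \<partial>(\<Pi>\<^sub>M i\<in>insert r ({..<m} - {r}). lborel))"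
    unfolding ins lebesgue_coords_def[symmetric] using N by (simp add: nn_integral_indicator)
  also have "\<dots> = (\<integral>\<^sup>+x. \<integral>\<^sup>+t. indicator ?N (x(r := t)) \<partial>lborel \<partial>(\<Pi>\<^sub>M i\<in>{..<m} - {r}. lborel))"
    by (rule lborel_product.product_nn_integral_insert[OF _ _ meas]) auto
  also have "\<dots> = (\<integral>\<^sup>+x. 0 \<partial>(\<Pi>\<^sub>M i\<in>{..<m} - {r}. (lborel :: real measure)))"
  proof (rule nn_integral_cong)
    fix x
    have "(\<integral>\<^sup>+t. indicator ?N (x(r := t)) \<partial>lborel) = (\<integral>\<^sup>+t. 0 \<partial>(lborel :: real measure))"
      by (intro nn_integral_cong_AE, use ae[of x] in eventually_elim) (auto split: split_indicator)
    then show "(\<integral>\<^sup>+t. indicator ?N (x(r := t)) \<partial>lborel) = 0" by simp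
  qed
  finally have "?N \<in> null_sets (lebesgue_coords m)" using N by (auto intro: null_setsI)
  from AE_not_in[OF this] AE_space show ?thesis by eventually_elim auto
qed

text \<open>The exchange matrix is an involution.\<close>

lemma det_exchange_nz: "det (mat p p (\<lambda>(i, j). if i + j + 1 = p then 1 else 0) :: complex mat) \<noteq> 0"
proof -
  let ?J = "mat p p (\<lambda>(i, j). if i + j + 1 = p then 1 else 0) :: complex mat"
  have "?J * ?J = 1\<^sub>m p"
  proof (rule eq_matI)
    fix i j assume ij: "i < dim_row (1\<^sub>m p :: complex mat)" "j < dim_col (1\<^sub>m p :: complex mat)"
    then have "(?J * ?J) $$ (i, j) = (\<Sum>k = 0..<p. (if i + k + 1 = p then 1 else 0) * (if k + j + 1 = p then 1 else 0))"
      by (auto simp: scalar_prod_def)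
    also have "\<dots> = (\<Sum>k = 0..<p. if k = p - 1 - i then (if i = j then 1 else 0) else 0)"
      using ij by (intro sum.cong refl) auto
    also have "\<dots> = 1\<^sub>m p $$ (i, j)" using ij by simp
    finally show "(?J * ?J) $$ (i, j) = 1\<^sub>m p $$ (i, j)" .
  qed auto
  then have "det ?J * det ?J = 1" using det_mult[of ?J p ?J] by simp
  then show ?thesis by auto
qed

text \<open>Vary only the real part of the coefficient on the main antidiagonal. The matrix is then
  \<open>A + t J\<close> with \<open>J\<close> the exchange matrix, so its determinant is a polynomial in \<open>t\<close> whose
  leading coefficient \<open>det J\<close> is not zero. The offset \<open>c\<close> covers both matrices of the pencil.\<close>

lemma AE_det_hankel_nz:
  assumes n: "even n" "n \<ge> 2" and c: "c \<le> 1"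
  shows "AE x in lebesgue_coords (2 * n). det (hankel (n div 2) (\<lambda>k. complex_coords n x (k + c))) \<noteq> 0"
proof -
  define p where "p = n div 2"
  define r where "r = p - 1 + c"
  have p: "p > 0" "n = 2 * p" using n by (auto simp: p_def)
  have r: "r < n" "i + j + c = r \<longleftrightarrow> i + j + 1 = p" for i j using p c by (auto simp: r_def)
  have lt: "i + j + c < n" if "i < p" "j < p" for i j using that p c by auto
  have "measurable_poly (coord_space (2 * n)) (\<lambda>x. det (map_mat (\<lambda>c. [:c:]) (hankel p (\<lambda>k. complex_coords n x (k + c)))))"
    by (rule measurable_poly_det[where p = p])
       (auto simp: hankel_def lt intro!: measurable_poly_const measurable_complex_coords)
  then have "(\<lambda>x. coeff (det (map_mat (\<lambda>c. [:c:]) (hankel p (\<lambda>k. complex_coords n x (k + c))))) 0) \<in> borel_measurable (coord_space (2 * n))"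
    unfolding measurable_poly_def by blast
  moreover have "coeff (det (map_mat (\<lambda>c. [:c:]) A)) 0 = det A" if "A \<in> carrier_mat p p" for A :: "complex mat"
  proof -
    have "poly (det (map_mat (\<lambda>c. [:c:]) A)) 0 = det (A + 0 \<cdot>\<^sub>m 0\<^sub>m p p)"
      by (rule det_linear_pencil) (use that in auto)
    also have "A + 0 \<cdot>\<^sub>m 0\<^sub>m p p = A" using that by auto
    finally show ?thesis by (simp add: poly_0_coeff_0)
  qed
  ultimately have [measurable]: "(\<lambda>x. det (hankel p (\<lambda>k. complex_coords n x (k + c)))) \<in> borel_measurable (coord_space (2 * n))"
    by simp
  have "AE x in lebesgue_coords (2 * n). det (hankel p (\<lambda>k. complex_coords n x (k + c))) \<noteq> 0"
  proof (rule AE_lebesgue_coords_coordinate[where r = r])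
    show "r < 2 * n" using r by simp
    show "{x \<in> space (coord_space (2 * n)). det (hankel p (\<lambda>k. complex_coords n x (k + c))) \<noteq> 0} \<in> sets (coord_space (2 * n))"
      by measurable
    fix x :: "nat \<Rightarrow> real"
    let ?A = "hankel p (\<lambda>k. complex_coords n (x(r := 0)) (k + c))"
    let ?J = "mat p p (\<lambda>(i, j). if i + j + 1 = p then 1 else 0) :: complex mat"
    let ?P = "mat p p (\<lambda>(i, j). [:?A $$ (i, j), ?J $$ (i, j):])"
    note pencil = det_linear_pencil[of ?P p ?A ?J]
    have "coeff (det ?P) p = det ?J" by (rule pencil(2)) auto
    then have nz: "det ?P \<noteq> 0" using det_exchange_nz[of p] by (metis coeff_0)
    have ev: "det (hankel p (\<lambda>k. complex_coords n (x(r := t)) (k + c))) = poly (det ?P) (of_real t)" for t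
    proof -
      have "poly (det ?P) (of_real t) = det (?A + of_real t \<cdot>\<^sub>m ?J)" by (rule pencil(3)) auto
      also have "?A + of_real t \<cdot>\<^sub>m ?J = hankel p (\<lambda>k. complex_coords n (x(r := t)) (k + c))"
        using r lt by (intro eq_matI) (auto simp: hankel_def complex_coords_def complex_eq_iff)
      finally show ?thesis by (rule sym)
    qed
    have "finite {t::real. poly (det ?P) (of_real t) = 0}"
    proof (rule finite_subset)
      show "{t::real. poly (det ?P) (of_real t) = 0} \<subseteq> Re ` {z. poly (det ?P) z = 0}" by force
      show "finite (Re ` {z. poly (det ?P) z = 0})" using poly_roots_finite[OF nz] by simp
    qed
    then have "{t::real. poly (det ?P) (of_real t) = 0} \<in> null_sets lborel"
      by (intro countable_imp_null_set_lborel countable_finite)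
    from AE_not_in[OF this]
    show "AE t in lborel. det (hankel p (\<lambda>k. complex_coords n (x(r := t)) (k + c))) \<noteq> 0"
      unfolding ev by simp
  qed
  then show ?thesis by (simp add: p_def)
qed

text \<open>The coefficient of degree \<open>n / 2\<close> is the determinant of the unshifted Hankel matrix up to sign.\<close>

lemma AE_regular:
  assumes n: "even n" "n \<ge> 2"
  shows "AE x in lebesgue_coords (2 * n). regular n x"
  using AE_det_hankel_nz[OF n, of 0, simplified]
proof eventually_elim
  case (elim x)
  have "- hankel (n div 2) (complex_coords n x) = (-1) \<cdot>\<^sub>m hankel (n div 2) (complex_coords n x)"
    by (rule eq_matI) (auto simp: hankel_def)
  with elim have "coeff (pade_poly n (complex_coords n x)) (n div 2) \<noteq> 0"
    by (simp add: coeff_pade_poly)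
  then show ?case by (simp add: regular_iff[OF n(2)])
qed

text \<open>The value at zero is the determinant of the shifted Hankel matrix.\<close>

lemma AE_no_zero_pole:
  assumes n: "even n" "n \<ge> 2"
  shows "AE x in lebesgue_coords (2 * n). 0 \<notin># poles_at n x"
  using AE_det_hankel_nz[OF n, of 1, simplified]
proof eventually_elim
  case (elim x)
  have "poly (pade_poly n (complex_coords n x)) 0 = det (hankel (n div 2) (\<lambda>k. complex_coords n x (Suc k)))"
    unfolding poly_pade_poly by (simp add: hankel_def)
  with elim have nz: "poly (pade_poly n (complex_coords n x)) 0 \<noteq> 0" by simp
  then have "pade_poly n (complex_coords n x) \<noteq> 0" by auto
  with nz show ?case by (simp add: poles_at_def pade_poles_def)
qed

section \<open>Dilations and the number of poles\<close>

text \<open>Multiplies the complex coefficient \<open>k\<close> by \<open>l ^ k\<close>, in real coordinates.\<close>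

definition dilate :: "nat \<Rightarrow> complex \<Rightarrow> (nat \<Rightarrow> real) \<Rightarrow> nat \<Rightarrow> real" where
  "dilate n l x = (\<lambda>i\<in>{..<2 * n}. if i < n then Re (l ^ i * complex_coords n x i)
     else Im (l ^ (i - n) * complex_coords n x (i - n)))"

lemma complex_coords_dilate: "k < n \<Longrightarrow> complex_coords n (dilate n l x) k = l ^ k * complex_coords n x k"
  by (subst complex_coords_def) (simp add: dilate_def complex_eq_iff)

lemma poles_at_dilate:
  assumes "even n" "l \<noteq> 0"
  shows "poles_at n (dilate n l x) = image_mset ((*) l) (poles_at n x)"
proof -
  have "pade_poles n (complex_coords n (dilate n l x)) = pade_poles n (\<lambda>k. l ^ k * complex_coords n x k)"
    unfolding pade_poles_def using assms(1)
    by (intro arg_cong[of _ _ proots] pade_poly_cong complex_coords_dilate)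
  then show ?thesis by (simp add: poles_at_def pade_poles_dilate[OF assms(2)])
qed

lemma poles_at_normalize:
  assumes "even n" "(\<Sum>i<2 * n. (x i)\<^sup>2) \<noteq> 0"
  shows "poles_at n (normalize_vec (2 * n) x) = poles_at n x"
proof -
  define c where "c = complex_of_real (1 / sqrt (\<Sum>i<2 * n. (x i)\<^sup>2))"
  have "c \<noteq> 0" using assms(2) by (simp add: c_def)
  have "complex_coords n (normalize_vec (2 * n) x) k = c * complex_coords n x k" if "k < n" for k
    using that by (simp add: complex_coords_def normalize_vec_def c_def complex_eq_iff)
  then have "pade_poles n (complex_coords n (normalize_vec (2 * n) x)) = pade_poles n (\<lambda>k. c * complex_coords n x k)"
    unfolding pade_poles_def using assms(1)
    by (intro arg_cong[of _ _ proots] pade_poly_cong)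
  then show ?thesis using \<open>c \<noteq> 0\<close> by (simp add: poles_at_def pade_poles_scale)
qed

lemma sum_lessThan_add:
  fixes f :: "nat \<Rightarrow> 'a::comm_monoid_add"
  shows "sum f {..<n + m} = sum f {..<n} + (\<Sum>i<m. f (n + i))"
  by (induction m) (simp_all add: add.assoc)

definition dilation_mat :: "nat \<Rightarrow> complex \<Rightarrow> real mat" where
  "dilation_mat n l = mat (2 * n) (2 * n) (\<lambda>(i, j). dilate n l (\<lambda>k. if k = j then 1 else 0) i)"

lemma dilation_mat_entries:
  assumes "i < n" "j < 2 * n"
  shows "dilation_mat n l $$ (i, j) = (if j = i then Re (l ^ i) else 0) - (if j = n + i then Im (l ^ i) else 0)"
    "dilation_mat n l $$ (n + i, j) = (if j = i then Im (l ^ i) else 0) + (if j = n + i then Re (l ^ i) else 0)"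
  using assms by (auto simp: dilation_mat_def dilate_def complex_coords_def)

lemma mat_act_dilation_mat: "mat_act (2 * n) (dilation_mat n l) x = dilate n l x"
proof
  fix i
  consider "i < n" | k where "i = n + k" "k < n" | "i \<ge> 2 * n"
  proof (cases "i < n \<or> i \<ge> 2 * n")
    case False
    then have "i = n + (i - n)" "i - n < n" by auto
    then show thesis using that by blast
  qed (use that in blast)
  then show "mat_act (2 * n) (dilation_mat n l) x i = dilate n l x i"
  proof cases
    case 1
    have "(\<Sum>j<2 * n. dilation_mat n l $$ (i, j) * x j)
      = (\<Sum>j<2 * n. (if j = i then Re (l ^ i) * x j else 0) - (if j = n + i then Im (l ^ i) * x j else 0))"
      using 1 by (intro sum.cong refl) (simp add: dilation_mat_entries)
    also have "\<dots> = Re (l ^ i) * x i - Im (l ^ i) * x (n + i)"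
      using 1 by (simp add: sum_subtractf)
    finally show ?thesis using 1 by (simp add: mat_act_def dilate_def complex_coords_def)
  next
    case 2
    have "(\<Sum>j<2 * n. dilation_mat n l $$ (n + k, j) * x j)
      = (\<Sum>j<2 * n. (if j = k then Im (l ^ k) * x j else 0) + (if j = n + k then Re (l ^ k) * x j else 0))"
      using 2 by (intro sum.cong refl) (simp add: dilation_mat_entries)
    also have "\<dots> = Im (l ^ k) * x k + Re (l ^ k) * x (n + k)"
      using 2 by (simp add: sum.distrib)
    finally show ?thesis using 2 by (simp add: mat_act_def dilate_def complex_coords_def)
  next
    case 3
    then show ?thesis by (simp add: mat_act_def dilate_def)
  qed
qed

text \<open>The matrix acts on the coordinates \<open>k\<close> and \<open>n + k\<close>, that is, on the real and imaginary part of
  one coefficient, as the plane rotation \<open>l ^ k\<close>.\<close>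

lemma orthogonal_dilation_mat:
  assumes "cmod l = 1"
  shows "orthogonal_mat (2 * n) (dilation_mat n l)"
proof (subst orthogonal_mat_iff)
  show "dilation_mat n l \<in> carrier_mat (2 * n) (2 * n)" by (simp add: dilation_mat_def)
  show "\<forall>j<2 * n. \<forall>m<2 * n. (\<Sum>i<2 * n. dilation_mat n l $$ (i, j) * dilation_mat n l $$ (i, m)) = (if j = m then 1 else 0)"
  proof (intro allI impI)
    fix j m assume jm: "j < 2 * n" "m < 2 * n"
    have uv: "Re (l ^ i) * Re (l ^ i) + Im (l ^ i) * Im (l ^ i) = 1" for i
    proof -
      have "cmod (l ^ i) = 1" using assms by (simp add: norm_power)
      then show ?thesis using cmod_power2[of "l ^ i"] by (simp add: power2_eq_square)
    qed
    have split: "(\<Sum>i<2 * n. dilation_mat n l $$ (i, j) * dilation_mat n l $$ (i, m))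
       = (\<Sum>i<n. dilation_mat n l $$ (i, j) * dilation_mat n l $$ (i, m)
            + dilation_mat n l $$ (n + i, j) * dilation_mat n l $$ (n + i, m))"
      using sum_lessThan_add[of "\<lambda>i. dilation_mat n l $$ (i, j) * dilation_mat n l $$ (i, m)" n n]
      by (simp add: mult_2 sum.distrib)
    also have "\<dots> = (\<Sum>i<n. (if i = j then if j = m then 1 else 0 else 0) + (if n + i = j then if j = m then 1 else 0 else 0))"
    proof (intro sum.cong refl)
      fix i assume "i \<in> {..<n}"
      then have i: "i < n" by simp
      show "dilation_mat n l $$ (i, j) * dilation_mat n l $$ (i, m) + dilation_mat n l $$ (n + i, j) * dilation_mat n l $$ (n + i, m)
        = (if i = j then if j = m then 1 else 0 else 0) + (if n + i = j then if j = m then 1 else 0 else 0)"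
        using i jm uv[of i] by (auto simp: dilation_mat_entries)
    qed
    also have "\<dots> = (if j = m then 1 else 0)"
    proof (cases "j < n")
      case True
      then show ?thesis by (auto simp: sum.distrib)
    next
      case False
      then have "(\<Sum>i<n. if n + i = j then if j = m then 1 else 0 else (0::real)) = (\<Sum>i<n. if i = j - n then if j = m then 1 else 0 else 0)"
        by (intro sum.cong refl) auto
      then show ?thesis using False jm by (auto simp: sum.distrib)
    qed
    finally show "(\<Sum>i<2 * n. dilation_mat n l $$ (i, j) * dilation_mat n l $$ (i, m)) = (if j = m then 1 else 0)" .
  qed
qed

text \<open>Setting the count to zero at degenerate points, where \<open>poles_at\<close> may have fewer elements or none,
  makes it a measurable function everywhere.\<close>

definition pole_count :: "nat \<Rightarrow> complex set \<Rightarrow> (nat \<Rightarrow> real) \<Rightarrow> ennreal" where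
  "pole_count n B x = (if regular n x then of_nat (size {#z \<in># poles_at n x. z \<in> B#}) else 0)"

lemma measurable_pole_count [measurable]:
  assumes n: "even n" "n \<ge> 2" and B: "B \<in> sets borel"
  shows "pole_count n B \<in> borel_measurable (coord_space (2 * n))"
proof -
  have [measurable]: "Measurable.pred (coord_space (2 * n)) (regular n)"
    using sets_regular[OF n] by (simp add: pred_def)
  obtain \<zeta> where \<zeta>: "\<And>j. j < n div 2 \<Longrightarrow> \<zeta> j \<in> borel_measurable (coord_space (2 * n))"
    "\<And>x. x \<in> space (coord_space (2 * n)) \<Longrightarrow> regular n x \<Longrightarrow>
       poles_at n x = image_mset (\<lambda>j. \<zeta> j x) (mset_set {..<n div 2})"
    using measurable_poles[OF n] by blast
  have "of_nat (size {#z \<in># image_mset (\<lambda>j. \<zeta> j x) (mset_set {..<p}). z \<in> B#}) = (\<Sum>j<p. indicator B (\<zeta> j x) :: ennreal)" for x p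
    by (induction p) (auto simp: lessThan_Suc add.commute)
  then have "pole_count n B x = (if regular n x then (\<Sum>j<n div 2. indicator B (\<zeta> j x)) else 0)"
    if "x \<in> space (coord_space (2 * n))" for x
    using that \<zeta>(2) by (simp add: pole_count_def)
  moreover have "(\<lambda>x. if regular n x then (\<Sum>j<n div 2. indicator B (\<zeta> j x)) else 0 :: ennreal) \<in> borel_measurable (coord_space (2 * n))"
  proof -
    have "(\<lambda>x. \<Sum>j<n div 2. indicator B (\<zeta> j x) :: ennreal) \<in> borel_measurable (coord_space (2 * n))"
    proof (intro borel_measurable_sum)
      fix j assume "j \<in> {..<n div 2}"
      then have [measurable]: "\<zeta> j \<in> borel_measurable (coord_space (2 * n))" using \<zeta>(1) by simp
      note B[measurable]
      show "(\<lambda>x. indicator B (\<zeta> j x) :: ennreal) \<in> borel_measurable (coord_space (2 * n))" by measurable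
    qed
    then show ?thesis by measurable
  qed
  ultimately show ?thesis by (subst measurable_cong) auto
qed

lemma regular_dilate: "even n \<Longrightarrow> l \<noteq> 0 \<Longrightarrow> regular n (dilate n l x) \<longleftrightarrow> regular n x"
  by (simp add: regular_def poles_at_dilate)

lemma size_filter_image_mset: "size {#z \<in># image_mset f A. P z#} = size {#z \<in># A. P (f z)#}"
  by (induction A) auto

lemma pole_count_dilate:
  "even n \<Longrightarrow> l \<noteq> 0 \<Longrightarrow> pole_count n B (dilate n l x) = pole_count n ((*) l -` B) x"
  by (simp add: pole_count_def regular_dilate poles_at_dilate size_filter_image_mset)

lemma pole_count_normalize:
  "even n \<Longrightarrow> (\<Sum>i<2 * n. (x i)\<^sup>2) \<noteq> 0 \<Longrightarrow> pole_count n B (normalize_vec (2 * n) x) = pole_count n B x"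
  by (simp add: pole_count_def regular_def poles_at_normalize)

text \<open>Lebesgue measure is its own image under the scaling up to the factor \<open>\<bar>c 0\<bar> * \<dots> * \<bar>c (m - 1)\<bar>\<close>.\<close>

lemma lebesgue_coords_scale_null:
  assumes c: "\<And>i. i < m \<Longrightarrow> c i \<noteq> 0" and A: "A \<in> sets (coord_space m)"
    and null: "emeasure (lebesgue_coords m) {x\<in>space (coord_space m). (\<lambda>i\<in>{..<m}. c i * x i) \<in> A} = 0"
  shows "emeasure (lebesgue_coords m) A = 0"
proof -
  define T where "T x = (\<lambda>i\<in>{..<m}. c i * x i)" for x :: "nat \<Rightarrow> real"
  have T [measurable]: "T \<in> measurable (coord_space m) (coord_space m)" unfolding T_def by measurable
  let ?D = "distr (lebesgue_coords m) (coord_space m) T"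
  let ?K = "\<Prod>i<m. ennreal \<bar>c i\<bar>"
  have "scale_measure ?K ?D = (\<Pi>\<^sub>M i\<in>{..<m}. lborel)"
  proof (rule lborel_product.PiM_eqI)
    show "sets (scale_measure ?K ?D) = sets (\<Pi>\<^sub>M i\<in>{..<m}. lborel)"
      by (simp add: sets_lebesgue_coords[unfolded lebesgue_coords_def])
    fix B assume "\<And>i. i \<in> {..<m} \<Longrightarrow> B i \<in> sets (lborel :: real measure)"
    then have B [measurable]: "B i \<in> sets borel" if "i < m" for i using that by simp
    have BP: "Pi\<^sub>E {..<m} B \<in> sets (coord_space m)" using B by (intro sets_PiM_I_finite) auto
    have one: "emeasure lborel (B i) = ennreal \<bar>c i\<bar> * emeasure lborel {t. c i * t \<in> B i}" if "i < m" for i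
    proof -
      note [measurable] = B[OF that]
      have "emeasure lborel (B i) = (\<integral>\<^sup>+t. indicator (B i) t \<partial>lborel)" by simp
      also have "\<dots> = ennreal \<bar>c i\<bar> * (\<integral>\<^sup>+t. indicator (B i) (0 + c i * t) \<partial>lborel)"
        using c[OF that] by (intro nn_integral_real_affine) auto
      also have "(\<integral>\<^sup>+t. indicator (B i) (0 + c i * t) \<partial>lborel) = (\<integral>\<^sup>+t. indicator {t. c i * t \<in> B i} t \<partial>lborel)"
        by (intro nn_integral_cong) (auto split: split_indicator)
      also have "\<dots> = emeasure lborel {t. c i * t \<in> B i}"
        by (intro nn_integral_indicator) measurable
      finally show ?thesis .
    qed
    have "emeasure ?D (Pi\<^sub>E {..<m} B) = emeasure (lebesgue_coords m) (T -` Pi\<^sub>E {..<m} B \<inter> space (coord_space m))"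
      using BP by (subst emeasure_distr) auto
    also have "T -` Pi\<^sub>E {..<m} B \<inter> space (coord_space m) = Pi\<^sub>E {..<m} (\<lambda>i. {t. c i * t \<in> B i})"
    proof (intro Set.set_eqI)
      fix x
      show "x \<in> T -` Pi\<^sub>E {..<m} B \<inter> space (coord_space m) \<longleftrightarrow> x \<in> Pi\<^sub>E {..<m} (\<lambda>i. {t. c i * t \<in> B i})"
        by (simp add: T_def space_PiM PiE_iff)
    qed
    also have "emeasure (lebesgue_coords m) \<dots> = (\<Prod>i<m. emeasure lborel {t. c i * t \<in> B i})"
      unfolding lebesgue_coords_def
    proof (rule lborel_product.emeasure_PiM)
      fix i assume "i \<in> {..<m}"
      then have [measurable]: "B i \<in> sets borel" using B by simp
      show "{t. c i * t \<in> B i} \<in> sets lborel" by measurable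
    qed simp
    finally show "emeasure (scale_measure ?K ?D) (Pi\<^sub>E {..<m} B) = (\<Prod>i<m. emeasure lborel (B i))"
      by (simp add: one prod.distrib)
  qed simp
  then have "emeasure (lebesgue_coords m) A = ?K * emeasure ?D A"
    unfolding lebesgue_coords_def by (metis emeasure_scale_measure)
  also have "emeasure ?D A = 0"
  proof -
    have "T -` A \<inter> space (lebesgue_coords m) = {x\<in>space (coord_space m). (\<lambda>i\<in>{..<m}. c i * x i) \<in> A}"
      unfolding T_def by auto
    then show ?thesis using A null by (subst emeasure_distr) simp_all
  qed
  finally show ?thesis by simp
qed

section \<open>The law of a random pole\<close>

lemma null_sets_lborel_scale_preimage:
  assumes R: "R \<in> null_sets (lborel :: real measure)" and c: "c > 0"
  shows "{r::real. c * r \<in> R} \<in> null_sets lborel"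
proof -
  have [measurable]: "R \<in> sets borel" using R by (auto simp: null_sets_def)
  have "0 = (\<integral>\<^sup>+t. indicator R t \<partial>(lborel :: real measure))" using R by (auto simp: null_sets_def)
  also have "\<dots> = ennreal \<bar>c\<bar> * (\<integral>\<^sup>+t. indicator R (0 + c * t) \<partial>lborel)"
    using c by (intro nn_integral_real_affine) auto
  also have "(\<integral>\<^sup>+t. indicator R (0 + c * t) \<partial>lborel) = (\<integral>\<^sup>+t. indicator {r. c * r \<in> R} t \<partial>lborel)"
    by (intro nn_integral_cong) (auto split: split_indicator)
  also have "\<dots> = emeasure lborel {r. c * r \<in> R}" by (intro nn_integral_indicator) measurable
  finally have "emeasure lborel {r. c * r \<in> R} = 0" using c by simp
  then show ?thesis by (intro null_setsI) measurable
qed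

text \<open>Let \<open>E\<close> be the set of vectors with a pole whose modulus is in \<open>R - {0}\<close>. For every fixed \<open>x\<close> the dilated
  vector \<open>T r x\<close> is in \<open>E\<close> only for a null set of \<open>r\<close>. By Fubini the preimage of \<open>E\<close> under
  \<open>T r\<close> is null for almost all \<open>r\<close>. One such \<open>r > 0\<close> suffices, as \<open>T r\<close> is a scaling of the coordinates.\<close>

lemma AE_no_pole_radius:
  assumes n: "even n" "n \<ge> 2" and R: "R \<in> null_sets (lborel :: real measure)"
  shows "AE x in lebesgue_coords (2 * n). pole_count n {z. cmod z \<in> R - {0}} x = 0"
proof -
  define B where "B = {z. cmod z \<in> R - {0}}"
  have [measurable]: "R \<in> sets borel" using R by (auto simp: null_sets_def)
  have B: "B \<in> sets borel" unfolding B_def by measurable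
  note pcm [measurable] = measurable_pole_count[OF n B]
  let ?S = "coord_space (2 * n)" and ?L = "lebesgue_coords (2 * n)"
  define T where "T r x = (\<lambda>i\<in>{..<2 * n}. r ^ (if i < n then i else i - n) * x i)" for r :: real and x :: "nat \<Rightarrow> real"
  have T: "T r x = dilate n (of_real r) x" for r x
    unfolding T_def dilate_def by (auto simp: complex_coords_def fun_eq_iff simp flip: of_real_power)
  have Tm [measurable]: "(\<lambda>(r, x). T r x) \<in> measurable (borel \<Otimes>\<^sub>M ?S) ?S"
    unfolding T_def by measurable
  define E where "E = {x\<in>space ?S. pole_count n B x \<noteq> 0}"
  have E [measurable]: "E \<in> sets ?S" unfolding E_def by measurable
  define F where "F = (\<lambda>r x. indicator {0<..} r * indicator E (T r x) :: ennreal)"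
  have Fm [measurable]: "(\<lambda>(r, x). F r x) \<in> borel_measurable (borel \<Otimes>\<^sub>M ?S)"
    unfolding F_def by measurable
  interpret L: sigma_finite_measure ?L by (rule sigma_finite_lebesgue_coords)
  interpret P: pair_sigma_finite "lborel :: real measure" ?L ..
  have "(\<integral>\<^sup>+r. \<integral>\<^sup>+x. F r x \<partial>?L \<partial>lborel) = (\<integral>\<^sup>+x. \<integral>\<^sup>+r. F r x \<partial>lborel \<partial>?L)"
    by (rule P.Fubini'[symmetric]) measurable
  also have "\<dots> = (\<integral>\<^sup>+x. 0 \<partial>?L)"
  proof (rule nn_integral_cong)
    fix x
    have "(\<Union>z\<in>set_mset (poles_at n x) - {0}. {r. cmod z * r \<in> R}) \<in> null_sets lborel"
      using null_sets_lborel_scale_preimage[OF R] by (intro null_sets_UN'[OF countable_finite]) auto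
    from AE_not_in[OF this] have "AE r in lborel. F r x = 0"
    proof eventually_elim
      case (elim r)
      show ?case
      proof (rule ccontr)
        assume "F r x \<noteq> 0"
        then have r: "r > 0" and "T r x \<in> E" by (auto simp: F_def indicator_eq_0_iff split: if_splits)
        then have "pole_count n ((*) (of_real r) -` B) x \<noteq> 0"
          using n(1) by (simp add: E_def T pole_count_dilate)
        then have "{#z \<in># poles_at n x. z \<in> (*) (of_real r) -` B#} \<noteq> {#}"
          by (auto simp: pole_count_def split: if_splits)
        then obtain z where "z \<in># {#z \<in># poles_at n x. z \<in> (*) (of_real r) -` B#}"
          by (meson multiset_nonemptyE)
        then have "z \<in># poles_at n x" "of_real r * z \<in> B" by simp_all
        then have "z \<in> set_mset (poles_at n x) - {0}" "cmod z * r \<in> R"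
          using r by (auto simp: B_def norm_mult mult.commute)
        with elim show False by blast
      qed
    qed
    then have "(\<integral>\<^sup>+r. F r x \<partial>lborel) = (\<integral>\<^sup>+r. 0 \<partial>(lborel :: real measure))"
      by (rule nn_integral_cong_AE)
    then show "(\<integral>\<^sup>+r. F r x \<partial>lborel) = 0" by simp
  qed
  finally have "(\<integral>\<^sup>+r. \<integral>\<^sup>+x. F r x \<partial>?L \<partial>lborel) = 0" by simp
  then have "AE r in lborel. (\<integral>\<^sup>+x. F r x \<partial>?L) = 0"
    by (subst (asm) nn_integral_0_iff_AE) measurable
  then have *: "AE r in lborel. 0 < r \<longrightarrow> emeasure ?L {x\<in>space ?S. T r x \<in> E} = 0"
  proof eventually_elim
    case (elim r)
    show ?case
    proof
      assume r: "0 < r"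
      have [measurable]: "T r \<in> measurable ?S ?S" unfolding T_def by measurable
      have "emeasure ?L {x\<in>space ?S. T r x \<in> E} = (\<integral>\<^sup>+x. indicator {x\<in>space ?S. T r x \<in> E} x \<partial>?L)"
        by (intro nn_integral_indicator[symmetric]) measurable
      also have "\<dots> = (\<integral>\<^sup>+x. F r x \<partial>?L)"
        using r by (intro nn_integral_cong) (auto simp: F_def split: split_indicator)
      finally show "emeasure ?L {x\<in>space ?S. T r x \<in> E} = 0" using elim by simp
    qed
  qed
  have "\<exists>r>0. emeasure ?L {x\<in>space ?S. T r x \<in> E} = 0"
  proof (rule ccontr)
    assume neg: "\<not> ?thesis"
    have "AE r in lborel. r \<notin> {0<..<1::real}"
      using * by eventually_elim (use neg in auto)
    then have "{0<..<1::real} \<in> null_sets lborel"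
      by (subst AE_iff_null_sets) auto
    then have "emeasure lborel {0<..<1::real} = 0" by (simp add: null_sets_def)
    moreover have "emeasure lborel {0<..<1::real} = ennreal (1 - 0)"
      by (rule emeasure_lborel_Ioo) simp
    ultimately show False by simp
  qed
  then obtain r where r: "r > 0" "emeasure ?L {x\<in>space ?S. T r x \<in> E} = 0" by blast
  have "emeasure ?L E = 0"
    by (rule lebesgue_coords_scale_null[where c = "\<lambda>i. r ^ (if i < n then i else i - n)"])
       (use r in \<open>auto simp: T_def[symmetric]\<close>)
  then have "E \<in> null_sets ?L" by (intro null_setsI) simp_all
  from AE_not_in[OF this] AE_space show ?thesis
    unfolding B_def[symmetric] by eventually_elim (auto simp: E_def)
qed

text \<open>The law of a pole that is drawn uniformly from the \<open>n div 2\<close> poles of a coefficient vector with law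
  \<open>\<mu>\<close>, provided that \<open>\<mu>\<close>-almost every vector is regular.\<close>

definition pole_law :: "nat \<Rightarrow> (nat \<Rightarrow> real) measure \<Rightarrow> complex measure" where
  "pole_law n \<mu> = measure_of UNIV (sets borel) (\<lambda>B. ennreal (2 / real n) * (\<integral>\<^sup>+x. pole_count n B x \<partial>\<mu>))"

lemma sets_pole_law [simp, measurable_cong]: "sets (pole_law n \<mu>) = sets borel"
  unfolding pole_law_def using sets.sigma_sets_eq[of "borel :: complex measure"]
  by (subst sets_measure_of) auto

lemma space_pole_law [simp]: "space (pole_law n \<mu>) = UNIV"
  using sets_eq_imp_space_eq[OF sets_pole_law] by simp

lemma pole_count_empty: "pole_count n {} = (\<lambda>x. 0)"
  by (auto simp: pole_count_def fun_eq_iff)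

lemma pole_count_countably_additive:
  assumes "disjoint_family A"
  shows "(\<Sum>i. pole_count n (A i) x) = pole_count n (\<Union>i. A i) x"
proof -
  have "(\<Sum>i. of_nat (size {#z \<in># P. z \<in> A i#}) :: ennreal) = of_nat (size {#z \<in># P. z \<in> (\<Union>i. A i)#})" for P :: "complex multiset"
  proof (induction P)
    case (add z P)
    have "(\<Sum>i. of_nat (size {#w \<in># add_mset z P. w \<in> A i#}) :: ennreal)
        = (\<Sum>i. indicator (A i) z + of_nat (size {#w \<in># P. w \<in> A i#}))"
      by (intro suminf_cong) auto
    also have "\<dots> = (\<Sum>i. indicator (A i) z) + (\<Sum>i. of_nat (size {#w \<in># P. w \<in> A i#}))"
      by (rule suminf_add[symmetric]) auto
    also have "(\<Sum>i. indicator (A i) z :: ennreal) = indicator (\<Union>i. A i) z"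
      using assms by (rule suminf_indicator)
    finally show ?case using add by (auto split: split_indicator)
  qed simp
  then show ?thesis by (simp add: pole_count_def)
qed

lemma emeasure_pole_law:
  assumes n: "even n" "n \<ge> 2" and \<mu>: "sets \<mu> = sets (coord_space (2 * n))" and B: "B \<in> sets borel"
  shows "emeasure (pole_law n \<mu>) B = ennreal (2 / real n) * (\<integral>\<^sup>+x. pole_count n B x \<partial>\<mu>)"
  unfolding pole_law_def
proof (rule emeasure_measure_of_sigma)
  have [measurable_cong]: "sets \<mu> = sets (coord_space (2 * n))" by fact
  show "sigma_algebra UNIV (sets (borel :: complex measure))"
    using sets.sigma_algebra_axioms[of "borel :: complex measure"] by simp
  show "positive (sets borel) (\<lambda>B. ennreal (2 / real n) * (\<integral>\<^sup>+x. pole_count n B x \<partial>\<mu>))"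
    by (simp add: positive_def pole_count_empty)
  show "countably_additive (sets borel) (\<lambda>B. ennreal (2 / real n) * (\<integral>\<^sup>+x. pole_count n B x \<partial>\<mu>))"
  proof (rule countably_additiveI)
    fix A :: "nat \<Rightarrow> complex set"
    assume A: "range A \<subseteq> sets borel" "disjoint_family A"
    have [measurable]: "pole_count n (A i) \<in> borel_measurable \<mu>" for i
      using measurable_pole_count[OF n, of "A i"] A(1) by (auto simp: measurable_cong_sets[OF \<mu> refl])
    have "(\<Sum>i. ennreal (2 / real n) * (\<integral>\<^sup>+x. pole_count n (A i) x \<partial>\<mu>))
        = ennreal (2 / real n) * (\<Sum>i. \<integral>\<^sup>+x. pole_count n (A i) x \<partial>\<mu>)" by (rule ennreal_suminf_cmult)
    also have "(\<Sum>i. \<integral>\<^sup>+x. pole_count n (A i) x \<partial>\<mu>) = (\<integral>\<^sup>+x. (\<Sum>i. pole_count n (A i) x) \<partial>\<mu>)"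
      by (rule nn_integral_suminf[symmetric]) measurable
    finally show "(\<Sum>i. ennreal (2 / real n) * (\<integral>\<^sup>+x. pole_count n (A i) x \<partial>\<mu>))
        = ennreal (2 / real n) * (\<integral>\<^sup>+x. pole_count n (\<Union>i. A i) x \<partial>\<mu>)"
      by (simp add: pole_count_countably_additive[OF A(2)])
  qed
qed (use B in simp)

lemma pole_law_prob_space:
  assumes n: "even n" "n \<ge> 2" and \<mu>: "sets \<mu> = sets (coord_space (2 * n))" "prob_space \<mu>"
    and reg: "AE x in \<mu>. regular n x"
  shows "prob_space (pole_law n \<mu>)"
proof (rule prob_spaceI)
  interpret prob_space \<mu> by fact
  have "(\<integral>\<^sup>+x. pole_count n UNIV x \<partial>\<mu>) = (\<integral>\<^sup>+x. of_nat (n div 2) \<partial>\<mu>)"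
    by (intro nn_integral_cong_AE, use reg in eventually_elim) (simp add: pole_count_def, simp add: regular_def)
  also have "\<dots> = of_nat (n div 2)" by (simp add: emeasure_space_1)
  finally have "emeasure (pole_law n \<mu>) UNIV = ennreal (2 / real n) * of_nat (n div 2)"
    using emeasure_pole_law[OF n \<mu>(1), of UNIV] by simp
  also have "\<dots> = ennreal (2 / real n * real (n div 2))"
    by (subst ennreal_mult) (simp_all add: ennreal_of_nat_eq_real_of_nat)
  also have "2 / real n * real (n div 2) = 1"
    using n by (auto elim!: evenE)
  finally show "emeasure (pole_law n \<mu>) (space (pole_law n \<mu>)) = 1" by simp
qed

text \<open>Rotating the poles by \<open>l\<close> is the same as applying an orthogonal map to the coefficients.\<close>

lemma pole_law_rotation:
  assumes n: "even n" "n \<ge> 2" and \<mu>: "orthogonally_invariant (2 * n) \<mu>"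
    and l: "cmod l = 1" and B: "B \<in> sets borel"
  shows "emeasure (pole_law n \<mu>) ((*) l -` B) = emeasure (pole_law n \<mu>) B"
proof -
  have s: "sets \<mu> = sets (coord_space (2 * n))" using \<mu> by (simp add: orthogonally_invariant_def)
  have [measurable_cong]: "sets \<mu> = sets (coord_space (2 * n))" by fact
  have l0: "l \<noteq> 0" using l by auto
  note measurable_pole_count[OF n B, measurable]
  have lB: "(*) l -` B \<in> sets borel"
    using measurable_sets[of "(*) l" borel borel B] B by simp
  have "(\<integral>\<^sup>+x. pole_count n B x \<partial>\<mu>)
      = (\<integral>\<^sup>+x. pole_count n B x \<partial>distr \<mu> (coord_space (2 * n)) (mat_act (2 * n) (dilation_mat n l)))"
    using \<mu> orthogonal_dilation_mat[OF l] by (simp add: orthogonally_invariant_def)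
  also have "\<dots> = (\<integral>\<^sup>+x. pole_count n B (mat_act (2 * n) (dilation_mat n l) x) \<partial>\<mu>)"
    by (rule nn_integral_distr) measurable
  also have "\<dots> = (\<integral>\<^sup>+x. pole_count n ((*) l -` B) x \<partial>\<mu>)"
    by (simp add: mat_act_dilation_mat pole_count_dilate[OF n(1) l0])
  finally show ?thesis by (simp add: emeasure_pole_law[OF n s] B lB)
qed

lemma pole_law_null_radius:
  assumes n: "even n" "n \<ge> 2" and s: "sets \<mu> = sets (coord_space (2 * n))"
    and ac: "\<And>P. (AE x in lebesgue_coords (2 * n). P x) \<Longrightarrow> (AE x in \<mu>. P x)"
    and R: "R \<in> null_sets (lborel :: real measure)"
  shows "emeasure (pole_law n \<mu>) {z. cmod z \<in> R} = 0"
proof -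
  have [measurable]: "R \<in> sets borel" using R by (auto simp: null_sets_def)
  have B: "{z. cmod z \<in> R} \<in> sets borel" by measurable
  have "AE x in lebesgue_coords (2 * n). pole_count n {z. cmod z \<in> R} x = 0"
    using AE_no_pole_radius[OF n R] AE_no_zero_pole[OF n]
  proof eventually_elim
    case (elim x)
    have "{#z \<in># poles_at n x. cmod z \<in> R#} = {#z \<in># poles_at n x. cmod z \<in> R - {0}#}"
      using elim(2) by (intro filter_mset_cong) auto
    with elim(1) show ?case by (cases "regular n x") (simp_all add: pole_count_def)
  qed
  from ac[OF this] have "(\<integral>\<^sup>+x. pole_count n {z. cmod z \<in> R} x \<partial>\<mu>) = (\<integral>\<^sup>+x. 0 \<partial>\<mu>)"
    by (rule nn_integral_cong_AE)
  then show ?thesis by (simp add: emeasure_pole_law[OF n s B])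
qed

text \<open>The poles depend on the direction of the coefficient vector only.\<close>

lemma pole_law_unique:
  assumes n: "even n" "n \<ge> 2"
    and \<mu>: "prob_space \<mu>" "orthogonally_invariant (2 * n) \<mu>" "AE x in \<mu>. (\<Sum>i<2 * n. (x i)\<^sup>2) \<noteq> 0"
    and \<nu>: "prob_space \<nu>" "orthogonally_invariant (2 * n) \<nu>" "AE x in \<nu>. (\<Sum>i<2 * n. (x i)\<^sup>2) \<noteq> 0"
  shows "pole_law n \<mu> = pole_law n \<nu>"
proof (rule measure_eqI)
  fix B assume "B \<in> sets (pole_law n \<mu>)"
  then have B: "B \<in> sets borel" by simp
  note measurable_pole_count[OF n B, measurable]
  have *: "(\<integral>\<^sup>+x. pole_count n B x \<partial>\<mu>) = (\<integral>\<^sup>+x. pole_count n B x \<partial>distr \<mu> (coord_space (2 * n)) (normalize_vec (2 * n)))"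
    if "orthogonally_invariant (2 * n) \<mu>" "AE x in \<mu>. (\<Sum>i<2 * n. (x i)\<^sup>2) \<noteq> 0" for \<mu>
  proof -
    have [measurable_cong]: "sets \<mu> = sets (coord_space (2 * n))" using that by (simp add: orthogonally_invariant_def)
    have "(\<integral>\<^sup>+x. pole_count n B x \<partial>distr \<mu> (coord_space (2 * n)) (normalize_vec (2 * n)))
        = (\<integral>\<^sup>+x. pole_count n B (normalize_vec (2 * n) x) \<partial>\<mu>)"
      by (rule nn_integral_distr) measurable
    also have "\<dots> = (\<integral>\<^sup>+x. pole_count n B x \<partial>\<mu>)"
      by (intro nn_integral_cong_AE, use that(2) in eventually_elim) (simp add: pole_count_normalize[OF n(1)])
    finally show ?thesis by simp
  qed
  show "emeasure (pole_law n \<mu>) B = emeasure (pole_law n \<nu>) B"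
    using \<mu>(2) \<nu>(2) *[OF \<mu>(2,3)] *[OF \<nu>(2,3)] directional_law_unique[OF \<mu> \<nu>]
    by (simp add: emeasure_pole_law[OF n _ B] orthogonally_invariant_def)
qed simp

section \<open>The condensed density\<close>

lemma AE_sum_sq_nz:
  assumes "m > 0"
  shows "AE x in lebesgue_coords m. (\<Sum>i<m. (x i)\<^sup>2) \<noteq> 0"
proof (rule AE_lebesgue_coords_coordinate[where r = 0])
  show "{x \<in> space (coord_space m). (\<Sum>i<m. (x i)\<^sup>2) \<noteq> 0} \<in> sets (coord_space m)" by measurable
  fix x :: "nat \<Rightarrow> real"
  show "AE t in lborel. (\<Sum>i<m. ((x(0 := t)) i)\<^sup>2) \<noteq> 0"
    using AE_lborel_singleton[of "0::real"]
  proof eventually_elim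
    case (elim t)
    have "0 < t\<^sup>2" using elim by simp
    also have "t\<^sup>2 = ((x(0 := t)) 0)\<^sup>2" by simp
    also have "\<dots> \<le> (\<Sum>i<m. ((x(0 := t)) i)\<^sup>2)" using assms by (intro member_le_sum) auto
    finally show ?case by simp
  qed
qed fact

lemma spherically_distributed_invariant:
  assumes "spherically_distributed M m X"
  shows "orthogonally_invariant m (distr M (coord_space m) X)"
  unfolding orthogonally_invariant_def
proof (intro conjI allI impI)
  fix Q assume Q: "orthogonal_mat m Q"
  have X: "X \<in> measurable M (coord_space m)" using assms by (simp add: spherically_distributed_def)
  have "distr (distr M (coord_space m) X) (coord_space m) (mat_act m Q) = distr M (coord_space m) (\<lambda>\<omega>. mat_act m Q (X \<omega>))"
    using X by (subst distr_distr) (auto simp: comp_def)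
  also have "\<dots> = distr M (coord_space m) X"
    using assms Q unfolding spherically_distributed_def orthogonal_mat_def mat_act_def by blast
  finally show "distr (distr M (coord_space m) X) (coord_space m) (mat_act m Q) = distr M (coord_space m) X" .
qed simp

lemma has_lebesgue_density_AE:
  assumes "has_lebesgue_density M m X" and ae: "AE x in lebesgue_coords m. P x"
  shows "AE x in distr M (coord_space m) X. P x"
proof -
  obtain f where f: "distributed M (lebesgue_coords m) X f"
    using assms(1) by (auto simp: has_lebesgue_density_def lebesgue_coords_def)
  have "distr M (coord_space m) X = distr M (lebesgue_coords m) X"
    by (rule distr_cong) auto
  also have "\<dots> = density (lebesgue_coords m) f"
    using f by (rule distributed_distr_eq_density)
  finally have eq: "distr M (coord_space m) X = density (lebesgue_coords m) f" .
  show ?thesis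
    unfolding eq AE_density[OF distributed_borel_measurable[OF f]]
    using ae by eventually_elim simp
qed

lemma poles_at_real_vector_of:
  assumes "even n"
  shows "poles_at n (real_vector_of n a \<omega>) = pade_poles n (\<lambda>k. a k \<omega>)"
  unfolding poles_at_def pade_poles_def
  by (intro arg_cong[of _ _ proots] pade_poly_cong assms)
     (simp add: complex_coords_def real_vector_of_def)

locale spherical_coefficients =
  fixes M :: "'w measure" and n :: nat and a :: "nat \<Rightarrow> 'w \<Rightarrow> complex"
  assumes n: "even n" "n \<ge> 2" and prob: "prob_space M"
    and spherical: "spherically_distributed M (2 * n) (real_vector_of n a)"
    and dens: "has_lebesgue_density M (2 * n) (real_vector_of n a)"
begin

definition "coeff_law = distr M (coord_space (2 * n)) (real_vector_of n a)"

lemma measurable_real_vector_of: "real_vector_of n a \<in> measurable M (coord_space (2 * n))"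
  using spherical by (simp add: spherically_distributed_def)

lemma sets_coeff_law: "sets coeff_law = sets (coord_space (2 * n))" by (simp add: coeff_law_def)

lemma prob_coeff_law: "prob_space coeff_law"
  unfolding coeff_law_def using prob measurable_real_vector_of by (rule prob_space.prob_space_distr)

lemma invariant_coeff_law: "orthogonally_invariant (2 * n) coeff_law"
  unfolding coeff_law_def by (rule spherically_distributed_invariant[OF spherical])

lemma AE_coeff_law: "(AE x in lebesgue_coords (2 * n). P x) \<Longrightarrow> (AE x in coeff_law. P x)"
  unfolding coeff_law_def by (rule has_lebesgue_density_AE[OF dens])

text \<open>\<open>pole_count\<close> differs from the number of poles only if the pencil is degenerate, a null event.\<close>

lemma emeasure_pole_law_coeff_law:
  assumes B: "B \<in> sets borel"
  shows "emeasure (pole_law n coeff_law) B = ennreal (2 / real n) *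
     (\<integral>\<^sup>+\<omega>. of_nat (size {#\<zeta> \<in># pade_poles n (\<lambda>k. a k \<omega>). \<zeta> \<in> B#}) \<partial>M)"
proof -
  have reg: "AE \<omega> in M. regular n (real_vector_of n a \<omega>)"
    using AE_coeff_law[OF AE_regular[OF n]] measurable_real_vector_of unfolding coeff_law_def by (rule AE_distrD[rotated])
  have "(\<integral>\<^sup>+x. pole_count n B x \<partial>coeff_law) = (\<integral>\<^sup>+\<omega>. pole_count n B (real_vector_of n a \<omega>) \<partial>M)"
    unfolding coeff_law_def by (rule nn_integral_distr) (use measurable_real_vector_of measurable_pole_count[OF n B] in auto)
  also have "\<dots> = (\<integral>\<^sup>+\<omega>. of_nat (size {#\<zeta> \<in># pade_poles n (\<lambda>k. a k \<omega>). \<zeta> \<in> B#}) \<partial>M)"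
    by (intro nn_integral_cong_AE, use reg in eventually_elim)
       (simp add: pole_count_def poles_at_real_vector_of[OF n(1)])
  finally show ?thesis by (simp add: emeasure_pole_law[OF n sets_coeff_law B])
qed

lemma condensed_density_iff:
  "condensed_density M n a h \<longleftrightarrow>
    h \<in> borel_measurable borel \<and> (\<forall>z. 0 \<le> h z) \<and> density lborel (\<lambda>z. ennreal (h z)) = pole_law n coeff_law"
proof (cases "h \<in> borel_measurable borel")
  case True
  then have [measurable]: "h \<in> borel_measurable borel" .
  have "density lborel (\<lambda>z. ennreal (h z)) = pole_law n coeff_law \<longleftrightarrow>
     (\<forall>B\<in>sets borel. emeasure (density lborel (\<lambda>z. ennreal (h z))) B = emeasure (pole_law n coeff_law) B)"
    by (auto intro: measure_eqI)
  then show ?thesis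
    unfolding condensed_density_def by (auto simp: emeasure_density emeasure_pole_law_coeff_law)
qed (simp add: condensed_density_def)

lemma radial_density:
  obtains g :: "real \<Rightarrow> real" where "g \<in> borel_measurable borel" "\<And>r. 0 \<le> g r"
    "pole_law n coeff_law = density lborel (\<lambda>z. ennreal (g (cmod z)))"
    "(\<integral>\<^sup>+r. indicator {0<..} r * ennreal (r * g r) \<partial>lborel) = ennreal (1 / (2 * pi))"
proof (rule rotation_invariant_radial_density)
  show "prob_space (pole_law n coeff_law)"
    by (rule pole_law_prob_space[OF n sets_coeff_law prob_coeff_law AE_coeff_law[OF AE_regular[OF n]]])
  show "sets (pole_law n coeff_law) = sets borel" by simp
  show "emeasure (pole_law n coeff_law) ((*) l -` B) = emeasure (pole_law n coeff_law) B" if "cmod l = 1" "B \<in> sets borel" for l B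
    by (rule pole_law_rotation[OF n invariant_coeff_law that])
  show "emeasure (pole_law n coeff_law) {z. cmod z \<in> R} = 0" if "R \<in> null_sets (lborel :: real measure)" for R
    by (rule pole_law_null_radius[OF n sets_coeff_law AE_coeff_law that])
qed (use that in blast)

lemma condensed_density_exists: "\<exists>h. condensed_density M n a h"
proof -
  obtain g where g: "g \<in> borel_measurable borel" "\<And>r. 0 \<le> g r"
    "pole_law n coeff_law = density lborel (\<lambda>z. ennreal (g (cmod z)))"
    using radial_density by blast
  note g(1)[measurable]
  have "condensed_density M n a (\<lambda>z. g (cmod z))"
    unfolding condensed_density_iff by (intro conjI) (measurable, use g in auto)
  then show ?thesis by blast
qed

lemma AE_eq_if_same_density:
  fixes h g :: "complex \<Rightarrow> real"
  assumes [measurable]: "h \<in> borel_measurable borel" "g \<in> borel_measurable borel"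
    and "\<And>z. 0 \<le> h z" "\<And>z. 0 \<le> g z"
    and "density lborel (\<lambda>z. ennreal (h z)) = density lborel (\<lambda>z. ennreal (g z))"
  shows "AE z in lborel. h z = g z"
proof -
  have "AE z in lborel. ennreal (h z) = ennreal (g z)"
    using assms(5) by (subst (asm) sigma_finite_measure.density_unique_iff[OF sigma_finite_lborel]) auto
  then show ?thesis using assms(3,4) by simp
qed

lemma condensed_density_unique:
  assumes "condensed_density M n a h" "condensed_density M n a g"
  shows "AE z in lborel. h z = g z"
  using assms by (intro AE_eq_if_same_density) (auto simp: condensed_density_iff)

text \<open>By uniqueness every version of the density is almost everywhere equal to a radial one, \<open>g (cmod z)\<close>.
  So almost everywhere \<open>polar_density h \<rho> \<theta> = \<rho> * g \<rho>\<close>, which does not involve \<open>\<theta>\<close>.\<close>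

lemma condensed_density_polar:
  assumes h: "condensed_density M n a h"
  shows "AE (\<rho>, \<theta>) in lborel. \<rho> > 0 \<longrightarrow> \<theta> \<in> {0<..2 * pi} \<longrightarrow>
           ennreal (polar_density h \<rho> \<theta>) = marginal_rho h \<rho> * ennreal (1 / (2 * pi))"
    and "AE \<theta> in lborel. \<theta> \<in> {0<..2 * pi} \<longrightarrow> marginal_theta h \<theta> = ennreal (1 / (2 * pi))"
proof -
  obtain g where g: "g \<in> borel_measurable borel" "\<And>r. 0 \<le> g r"
    "pole_law n coeff_law = density lborel (\<lambda>z. ennreal (g (cmod z)))"
    "(\<integral>\<^sup>+r. indicator {0<..} r * ennreal (r * g r) \<partial>lborel) = ennreal (1 / (2 * pi))"
    using radial_density by blast
  note [measurable] = g(1)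
  have hm [measurable]: "h \<in> borel_measurable borel" using h by (simp add: condensed_density_iff)
  have hg: "AE z in lborel. h z = g (cmod z)"
    using h g by (intro AE_eq_if_same_density) (auto simp: condensed_density_iff)
  have P: "{z. h z = g (cmod z)} \<in> sets borel" by measurable
  have polar: "polar_density h r t = r * g r" if "0 < r" "h (rcis r t) = g (cmod (rcis r t))" for r t
    using that by (simp add: polar_density_def)
  have [measurable]: "(\<lambda>(r, t). polar_density h r t) \<in> borel_measurable (borel \<Otimes>\<^sub>M borel)"
    unfolding polar_density_def by measurable
  have mm [measurable]: "marginal_rho h \<in> borel_measurable borel"
    unfolding marginal_rho_def by measurable
  have ae: "AE r in lborel. AE t in lborel. 0 < r \<longrightarrow> t \<in> {0<..2 * pi} \<longrightarrow>
     ennreal (polar_density h r t) = marginal_rho h r * ennreal (1 / (2 * pi))"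
    using AE_polar(2)[OF P hg]
  proof eventually_elim
    case (elim r)
    show ?case
    proof (cases "r > 0")
      case r: True
      have "marginal_rho h r = (\<integral>\<^sup>+t. ennreal (r * g r) * indicator {0<..2 * pi} t \<partial>lborel)"
        unfolding marginal_rho_def
        by (intro nn_integral_cong_AE, use elim in eventually_elim) (auto simp: polar r split: split_indicator)
      also have "\<dots> = ennreal (r * g r) * ennreal (2 * pi)"
        by (subst nn_integral_cmult_indicator) auto
      finally have "marginal_rho h r * ennreal (1 / (2 * pi)) = ennreal (r * g r) * (ennreal (2 * pi) * ennreal (1 / (2 * pi)))"
        by (simp add: mult.assoc)
      also have "ennreal (2 * pi) * ennreal (1 / (2 * pi)) = 1"
        by (subst ennreal_mult[symmetric]) auto
      finally have m: "marginal_rho h r * ennreal (1 / (2 * pi)) = ennreal (r * g r)" by simp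
      from elim show ?thesis by eventually_elim (auto simp: polar r m)
    qed auto
  qed
  have "AE x in lborel \<Otimes>\<^sub>M lborel. 0 < fst x \<longrightarrow> snd x \<in> {0<..2 * pi} \<longrightarrow>
     ennreal (polar_density h (fst x) (snd x)) = marginal_rho h (fst x) * ennreal (1 / (2 * pi))"
  proof (rule lborel_pair.AE_pair_measure)
    have [measurable]: "(\<lambda>x. polar_density h (fst x) (snd x)) \<in> borel_measurable (borel \<Otimes>\<^sub>M borel)"
      unfolding polar_density_def by measurable
    show "{x \<in> space (lborel \<Otimes>\<^sub>M lborel). 0 < fst x \<longrightarrow> snd x \<in> {0<..2 * pi} \<longrightarrow>
       ennreal (polar_density h (fst x) (snd x)) = marginal_rho h (fst x) * ennreal (1 / (2 * pi))} \<in> sets (lborel \<Otimes>\<^sub>M lborel)"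
      by measurable
  qed (use ae in \<open>simp only: fst_conv snd_conv\<close>)
  then show "AE (\<rho>, \<theta>) in lborel. \<rho> > 0 \<longrightarrow> \<theta> \<in> {0<..2 * pi} \<longrightarrow>
           ennreal (polar_density h \<rho> \<theta>) = marginal_rho h \<rho> * ennreal (1 / (2 * pi))"
    by (simp only: lborel_prod case_prod_unfold)
  show "AE \<theta> in lborel. \<theta> \<in> {0<..2 * pi} \<longrightarrow> marginal_theta h \<theta> = ennreal (1 / (2 * pi))"
    using AE_polar(1)[OF P hg]
  proof eventually_elim
    case (elim t)
    show ?case
    proof
      assume t: "t \<in> {0<..2 * pi}"
      have "marginal_theta h t = (\<integral>\<^sup>+r. indicator {0<..} r * ennreal (r * g r) \<partial>lborel)"
        unfolding marginal_theta_def
        by (intro nn_integral_cong_AE, use elim in eventually_elim) (use t in \<open>auto simp: polar split: split_indicator\<close>)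
      then show "marginal_theta h t = ennreal (1 / (2 * pi))" using g(4) by simp
    qed
  qed
qed

text \<open>The poles of the scaled coefficients are the same at every outcome.\<close>

lemma condensed_density_scale:
  assumes "c > 0"
  shows "condensed_density M n (\<lambda>k \<omega>. complex_of_real c * a k \<omega>) h \<longleftrightarrow> condensed_density M n a h"
  using assms by (simp add: condensed_density_def pade_poles_scale)

end

lemma pole_law_distribution_free:
  assumes "spherical_coefficients M n a" "spherical_coefficients M' n a'"
  shows "pole_law n (spherical_coefficients.coeff_law M n a) = pole_law n (spherical_coefficients.coeff_law M' n a')"
proof -
  interpret X: spherical_coefficients M n a by fact
  interpret Y: spherical_coefficients M' n a' by fact
  have "2 * n > 0" using X.n by simp
  note nz = AE_sum_sq_nz[OF this]
  show ?thesis
    by (rule pole_law_unique[OF X.n X.prob_coeff_law X.invariant_coeff_law X.AE_coeff_law[OF nz] Y.prob_coeff_law Y.invariant_coeff_law Y.AE_coeff_law[OF nz]])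
qed

theorem theorem3:
  fixes M :: "'w measure" and M' :: "'v measure"
    and a :: "nat \<Rightarrow> 'w \<Rightarrow> complex" and a' :: "nat \<Rightarrow> 'v \<Rightarrow> complex"
    and n :: nat
  assumes "even n" and "n > 2"
    and "prob_space M"
    and "\<And>k. k < n \<Longrightarrow> a k \<in> borel_measurable M"
    and "spherically_distributed M (2 * n) (real_vector_of n a)"
    and "has_lebesgue_density M (2 * n) (real_vector_of n a)"
    and "prob_space M'"
    and "\<And>k. k < n \<Longrightarrow> a' k \<in> borel_measurable M'"
    and "spherically_distributed M' (2 * n) (real_vector_of n a')"
    and "has_lebesgue_density M' (2 * n) (real_vector_of n a')"
  shows
    \<comment> \<open>the condensed density exists and is unique up to null sets\<close>
    "(\<exists>h. condensed_density M n a h) \<and>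
     (\<forall>h g. condensed_density M n a h \<longrightarrow> condensed_density M n a g \<longrightarrow>
        (AE z in lborel. h z = g z)) \<and>
     \<comment> \<open>(1) it does not depend on the distribution\<close>
     (\<forall>h. condensed_density M n a h \<longleftrightarrow> condensed_density M' n a' h) \<and>
     \<comment> \<open>(2) polar coordinates\<close>
     (\<forall>h. condensed_density M n a h \<longrightarrow>
        (AE (\<rho>, \<theta>) in lborel. \<rho> > 0 \<longrightarrow> \<theta> \<in> {0<..2 * pi} \<longrightarrow>
           ennreal (polar_density h \<rho> \<theta>) = marginal_rho h \<rho> * ennreal (1 / (2 * pi))) \<and>
        (AE \<theta> in lborel. \<theta> \<in> {0<..2 * pi} \<longrightarrow>
           marginal_theta h \<theta> = ennreal (1 / (2 * pi)))) \<and>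
     \<comment> \<open>(3) invariance under scaling\<close>
     (\<forall>c::real. c > 0 \<longrightarrow>
        (\<forall>h. condensed_density M n (\<lambda>k \<omega>. complex_of_real c * a k \<omega>) h
             \<longleftrightarrow> condensed_density M n a h))"
proof -
  have "n \<ge> 2" using assms(2) by simp
  then have X: "spherical_coefficients M n a" and Y: "spherical_coefficients M' n a'"
    using assms(1,3,5-7,9,10) by (simp_all only: spherical_coefficients_def)
  interpret X: spherical_coefficients M n a by (rule X)
  interpret Y: spherical_coefficients M' n a' by (rule Y)
  have "pole_law n X.coeff_law = pole_law n Y.coeff_law"
    using X Y by (rule pole_law_distribution_free)
  then have free: "condensed_density M n a h \<longleftrightarrow> condensed_density M' n a' h" for h
    by (simp add: X.condensed_density_iff Y.condensed_density_iff)
  show ?thesis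
  proof (intro conjI allI impI)
    fix h c
    show "\<exists>h. condensed_density M n a h" by (rule X.condensed_density_exists)
    show "condensed_density M n a h \<longleftrightarrow> condensed_density M' n a' h" by (rule free)
    show "condensed_density M n (\<lambda>k \<omega>. complex_of_real c * a k \<omega>) h \<longleftrightarrow> condensed_density M n a h"
      if "c > 0" using that by (rule X.condensed_density_scale)
    assume h: "condensed_density M n a h"
    show "AE z in lborel. h z = g z" if "condensed_density M n a g" for g
      using h that by (rule X.condensed_density_unique)
    from X.condensed_density_polar[OF h]
    show "AE (\<rho>, \<theta>) in lborel. \<rho> > 0 \<longrightarrow> \<theta> \<in> {0<..2 * pi} \<longrightarrow>
           ennreal (polar_density h \<rho> \<theta>) = marginal_rho h \<rho> * ennreal (1 / (2 * pi))"
      and "AE \<theta> in lborel. \<theta> \<in> {0<..2 * pi} \<longrightarrow> marginal_theta h \<theta> = ennreal (1 / (2 * pi))"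
      by blast+
  qed
qed

end
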